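(* Let the conditions (K1)--(K4) of the context be satisfied, and suppose that the solution $u$ of $\dot u+A(u)u=f(u)$ has the regularity $u\in C^3([0,T],Y)$ with $Su\in C^2([0,T],Y)$. Let $t_n=n\tau$ and let $u_n$ be the numerical solution with initial value $u_0=u(0)$ determined, for $n=0,1,2,\dots$, by $$\frac{u_{n+1}-u_n}{\tau}+A(\widehat u_{n+1/2})\frac{u_{n+1}+u_n}{2}=f(\widehat u_{n+1/2}),$$ where either $\widehat u_{n+1/2}=\frac{u_{n+1}+u_n}2$ (fully implicit midpoint rule), or $\widehat u_{n+1/2}=u_n+\tfrac12(u_n-u_{n-1})$ with $\widehat u_{1/2}=u_0$ in the first step (linearly implicit midpoint rule). Then there exists $\bar\tau>0$ such that for stepsizes $0<\tau\le\bar\tau$, the errors of the fully implicit and of the linearly implicit midpoint rule are bounded by $$\|u_n-u(t_n)\|\le C\tau^2,$$ where $C$ is independent of $n$ and $\tau$ with $0\le n\tau\le T$.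
   Context: Let $X$ and $Y$ be real Hilbert spaces such that $Y$ is densely and continuously embedded in $X$. The inner product on $X$ is $(\cdot,\cdot)$, and the norms are $|\cdot|=\|\cdot\|_X$ and $\|\cdot\|=\|\cdot\|_Y$, chosen such that $|y|\le\|y\|$ for all $y\in Y$. For every $R>0$ the following conditions hold, with real numbers $M_R^A,M_R^B,L_R^A,L_R^B,\ell_R^X,\ell_R^Y$ depending only on $R$. (K1) For every $y\in Y$, the closed linear operator $A(y)$ on $X$, with domain $D(A(y))$, has the open left complex half-plane in the resolvent set and satisfies $(w,A(y)w)\ge0$ for all $w\in D(A(y))$. Moreover, $D(A(y))$ contains $Y$, and for $y\in Y$ with $\|y\|\le R$, $|A(y)w|\le M_R^A\|w\|$ for all $w\in Y$. (K2) There exists an isometry $S:Y\to X$, self-adjoint as a linear operator on $X$, such that for every $y\in Y$ with $\|y\|\le R$, $SA(y)S^{-1}=A(y)+B(y)$ (with equality of domains), where $|B(y)v|\le M_R^B|v|$ for all $v\in X$. (K3) For all $y,\widetilde y\in Y$ with $\|y\|\le R$, $\|\widetilde y\|\le R$: $|(A(y)-A(\widetilde y))w|\le L_R^A|y-\widetilde y|\,\|w\|$ for all $w\in Y$, and $|(B(y)-B(\widetilde y))v|\le L_R^B\|y-\widetilde y\|\,|v|$ for all $v\in X$. (K4) The function $f:X\to X$ is $Y$-locally Lipschitz-continuous in $X$ and $Y$: for all $y,\widetilde y\in Y$ with $\|y\|\le R$, $\|\widetilde y\|\le R$, $|f(y)-f(\widetilde y)|\le\ell_R^X|y-\widetilde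 y|$ and $\|f(y)-f(\widetilde y)\|\le\ell_R^Y\|y-\widetilde y\|$.
   Formalization: For the fully implicit rule, whose step equation can have spurious far-away solutions, the bound is proved for numerical solutions staying in a Y-ball of any fixed radius R > max‖u(t)‖ (with existence of one), where the stepsize bound and C may depend on R. *)

theory Defs
  imports "HOL-Analysis.Analysis"
begin

text \<open>
  The Hilbert space \<open>X\<close> is the type \<open>'x\<close>, the Hilbert space \<open>Y\<close> is the type \<open>'y\<close>, and the inclusion
  of \<open>Y\<close> in \<open>X\<close> is an explicit injective map \<open>j\<close>; an element of \<open>X\<close> belongs to \<open>Y\<close> iff it is in
  \<open>range j\<close>. A partially defined operator on \<open>X\<close> is a domain \<open>D\<close> together with a function \<open>F\<close> whose
  values outside \<open>D\<close> are irrelevant.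
\<close>

definition dense_embedding ::
    "('y::{real_inner,complete_space} \<Rightarrow> 'x::{real_inner,complete_space}) \<Rightarrow> bool" where
  "dense_embedding j \<longleftrightarrow>
     linear j \<and> inj j \<and> closure (range j) = UNIV \<and> (\<forall>y. norm (j y) \<le> norm y)"

definition op_graph :: "'x set \<Rightarrow> ('x \<Rightarrow> 'x) \<Rightarrow> ('x \<times> 'x) set" where
  "op_graph D F = {(w, F w) | w. w \<in> D}"

definition closed_linear_operator :: "'x::real_inner set \<Rightarrow> ('x \<Rightarrow> 'x) \<Rightarrow> bool" where
  "closed_linear_operator D F \<longleftrightarrow> subspace (op_graph D F) \<and> closed (op_graph D F)"

text \<open>
  The spectrum of an operator on a real space is that of its complexification. The
  complexification of \<open>X\<close> is \<open>X \<times> X\<close>, with \<open>(v, w)\<close> standing for \<open>v + i w\<close>; the product norm is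
  the Hilbert norm of the complexification.
\<close>

definition complexified_shift ::
    "('x::real_vector \<Rightarrow> 'x) \<Rightarrow> complex \<Rightarrow> 'x \<times> 'x \<Rightarrow> 'x \<times> 'x" where
  "complexified_shift F l = (\<lambda>(v, w).
     (Re l *\<^sub>R v - Im l *\<^sub>R w - F v, Re l *\<^sub>R w + Im l *\<^sub>R v - F w))"

definition resolvent_set :: "'x::real_inner set \<Rightarrow> ('x \<Rightarrow> 'x) \<Rightarrow> complex set" where
  "resolvent_set D F = {l.
     bij_betw (complexified_shift F l) (D \<times> D) UNIV \<and>
     bounded_linear (the_inv_into (D \<times> D) (complexified_shift F l))}"

text \<open>The graph of the Hilbert space adjoint of a densely defined operator with graph \<open>G\<close>.\<close>

definition adjoint_graph :: "('x::real_inner \<times> 'x) set \<Rightarrow> ('x \<times> 'x) set" where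
  "adjoint_graph G = {(v, z). \<forall>(w, x)\<in>G. inner x v = inner w z}"

definition kato_K1 ::
    "('y::{real_inner,complete_space} \<Rightarrow> 'x::{real_inner,complete_space}) \<Rightarrow>
     ('y \<Rightarrow> 'x set) \<Rightarrow> ('y \<Rightarrow> 'x \<Rightarrow> 'x) \<Rightarrow> (real \<Rightarrow> real) \<Rightarrow> bool" where
  "kato_K1 j D A MA \<longleftrightarrow>
     (\<forall>y. closed_linear_operator (D y) (A y) \<and>
          {l. Re l < 0} \<subseteq> resolvent_set (D y) (A y) \<and>
          (\<forall>w\<in>D y. 0 \<le> inner w (A y w)) \<and>
          range j \<subseteq> D y) \<and>
     (\<forall>R>0. \<forall>y. norm y \<le> R \<longrightarrow> (\<forall>w. norm (A y (j w)) \<le> MA R * norm w))"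

text \<open>
  \<open>S : Y \<rightarrow> X\<close> has the graph \<open>{(j w, S w)}\<close> as an operator on \<open>X\<close>. In \<open>S A(y) S\<^sup>-\<^sup>1\<close> the relational
  product \<open>(O)\<close> applies its left factor first; equality of graphs includes equality of domains.
\<close>

definition kato_K2 ::
    "('y::{real_inner,complete_space} \<Rightarrow> 'x::{real_inner,complete_space}) \<Rightarrow>
     ('y \<Rightarrow> 'x set) \<Rightarrow> ('y \<Rightarrow> 'x \<Rightarrow> 'x) \<Rightarrow> ('y \<Rightarrow> 'x) \<Rightarrow> ('y \<Rightarrow> 'x \<Rightarrow> 'x) \<Rightarrow> (real \<Rightarrow> real) \<Rightarrow> bool" where
  "kato_K2 j D A S B MB \<longleftrightarrow>
     linear S \<and> (\<forall>w. norm (S w) = norm w) \<and>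
     (let G = range (\<lambda>w. (j w, S w)) in
        adjoint_graph G = G \<and>
        (\<forall>R>0. \<forall>y. norm y \<le> R \<longrightarrow>
           G\<inverse> O op_graph (D y) (A y) O G = op_graph (D y) (\<lambda>v. A y v + B y v) \<and>
           linear (B y) \<and> (\<forall>v. norm (B y v) \<le> MB R * norm v)))"

definition kato_K3 ::
    "('y::{real_inner,complete_space} \<Rightarrow> 'x::{real_inner,complete_space}) \<Rightarrow>
     ('y \<Rightarrow> 'x \<Rightarrow> 'x) \<Rightarrow> ('y \<Rightarrow> 'x \<Rightarrow> 'x) \<Rightarrow> (real \<Rightarrow> real) \<Rightarrow> (real \<Rightarrow> real) \<Rightarrow> bool" where
  "kato_K3 j A B LA LB \<longleftrightarrow>
     (\<forall>R>0. \<forall>y y'. norm y \<le> R \<and> norm y' \<le> R \<longrightarrow>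
        (\<forall>w. norm (A y (j w) - A y' (j w)) \<le> LA R * norm (j y - j y') * norm w) \<and>
        (\<forall>v. norm (B y v - B y' v) \<le> LB R * norm (y - y') * norm v))"

text \<open>The second estimate includes that the difference of the values of \<open>f\<close> belongs to \<open>Y\<close>.\<close>

definition kato_K4 ::
    "('y::{real_inner,complete_space} \<Rightarrow> 'x::{real_inner,complete_space}) \<Rightarrow>
     ('x \<Rightarrow> 'x) \<Rightarrow> (real \<Rightarrow> real) \<Rightarrow> (real \<Rightarrow> real) \<Rightarrow> bool" where
  "kato_K4 j f lX lY \<longleftrightarrow>
     (\<forall>R>0. \<forall>y y'. norm y \<le> R \<and> norm y' \<le> R \<longrightarrow>
        norm (f (j y) - f (j y')) \<le> lX R * norm (j y - j y') \<and>
        (\<exists>d. j d = f (j y) - f (j y') \<and> norm d \<le> lY R * norm (y - y')))"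

text \<open>\<open>k\<close> times continuously differentiable on \<open>I\<close>, with one-sided derivatives at end points.\<close>

primrec Ck_on :: "nat \<Rightarrow> real set \<Rightarrow> (real \<Rightarrow> 'a::real_normed_vector) \<Rightarrow> bool" where
  "Ck_on 0 I g \<longleftrightarrow> continuous_on I g"
| "Ck_on (Suc k) I g \<longleftrightarrow>
     (\<exists>g'. (\<forall>t\<in>I. (g has_vector_derivative g' t) (at t within I)) \<and> Ck_on k I g')"

definition evolution_solution ::
    "('y::{real_inner,complete_space} \<Rightarrow> 'x::{real_inner,complete_space}) \<Rightarrow>
     ('y \<Rightarrow> 'x \<Rightarrow> 'x) \<Rightarrow> ('x \<Rightarrow> 'x) \<Rightarrow> real \<Rightarrow> (real \<Rightarrow> 'y) \<Rightarrow> bool" where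
  "evolution_solution j A f T u \<longleftrightarrow>
     (\<forall>t\<in>{0..T}. \<exists>u'. ((\<lambda>s. j (u s)) has_vector_derivative u') (at t within {0..T}) \<and>
        u' + A (u t) (j (u t)) = f (j (u t)))"

text \<open>The two choices of the argument \<open>u\<^sub>n\<^sub>+\<^sub>1\<^sub>/\<^sub>2\<close> (with a hat), as functions of the sequence.\<close>

definition implicit_mid :: "(nat \<Rightarrow> 'y::real_vector) \<Rightarrow> nat \<Rightarrow> 'y" where
  "implicit_mid us n = (1/2) *\<^sub>R (us (Suc n) + us n)"

definition extrapolated_mid :: "(nat \<Rightarrow> 'y::real_vector) \<Rightarrow> nat \<Rightarrow> 'y" where
  "extrapolated_mid us n =
     (if n = 0 then us 0 else us n + (1/2) *\<^sub>R (us n - us (n - 1)))"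

text \<open>Only the grid points in \<open>[0, T]\<close> matter; later members of \<open>us\<close> are arbitrary.\<close>

definition midpoint_solution ::
    "('y::{real_inner,complete_space} \<Rightarrow> 'x::{real_inner,complete_space}) \<Rightarrow>
     ('y \<Rightarrow> 'x \<Rightarrow> 'x) \<Rightarrow> ('x \<Rightarrow> 'x) \<Rightarrow> ((nat \<Rightarrow> 'y) \<Rightarrow> nat \<Rightarrow> 'y) \<Rightarrow>
     real \<Rightarrow> real \<Rightarrow> 'y \<Rightarrow> (nat \<Rightarrow> 'y) \<Rightarrow> bool" where
  "midpoint_solution j A f mid T \<tau> y0 us \<longleftrightarrow>
     us 0 = y0 \<and>
     (\<forall>n. real (Suc n) * \<tau> \<le> T \<longrightarrow>
        (1 / \<tau>) *\<^sub>R j (us (Suc n) - us n)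
          + A (mid us n) (j ((1/2) *\<^sub>R (us (Suc n) + us n)))
        = f (j (mid us n)))"

definition bounded_on_grid :: "real \<Rightarrow> real \<Rightarrow> real \<Rightarrow> (nat \<Rightarrow> 'y::real_normed_vector) \<Rightarrow> bool" where
  "bounded_on_grid R T \<tau> us \<longleftrightarrow> (\<forall>n. real n * \<tau> \<le> T \<longrightarrow> norm (us n) \<le> R)"

end

theory Submission
  imports Defs
begin

text \<open>
  The proof is an energy estimate in the norm of \<open>Y\<close>. Because \<open>S\<close> is an isometry from \<open>Y\<close> to \<open>X\<close>, the
  \<open>Y\<close>-norm of an error \<open>e\<close> is the \<open>X\<close>-norm of \<open>S e\<close>. Conjugation by \<open>S\<close> turns \<open>A(y)\<close> into \<open>A(y) + B(y)\<close>, a bounded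
  perturbation of a monotone operator, and the midpoint rule inherits the energy inequality of the
  evolution equation: testing the error equation with the average of two consecutive errors gives
  \<open>\<parallel>e\<^sub>n\<^sub>+\<^sub>1\<parallel> \<le> \<parallel>e\<^sub>n\<parallel> + \<tau> (\<bar>MB\<bar> (\<parallel>e\<^sub>n\<^sub>+\<^sub>1\<parallel> + \<parallel>e\<^sub>n\<parallel>) + \<bar>r\<bar>)\<close> with a residual \<open>r\<close> (\<open>energy_estimate\<close>).

  The residual compares the numerical step with the exact equation at the midpoint of the time interval.
  It consists of consistency defects of size \<open>\<tau>\<^sup>2\<close>, which need three derivatives of \<open>u\<close> and two of \<open>S u\<close>, and
  of differences of operators with different arguments applied to the exact solution. The latter are
  bounded in \<open>Y\<close> by the error of the argument, because \<open>S u\<close> takes values in \<open>Y\<close> (\<open>one_step_error\<close>). For both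
  choices of the argument this error is at most a combination of neighbouring errors plus a term of
  size \<open>\<tau>\<^sup>2\<close>; the only exception is the first step of the linearly implicit rule, where the term has size
  \<open>\<tau>\<close> but contributes only \<open>\<tau>\<^sup>2\<close> to the error. A discrete Gronwall inequality (\<open>discrete_gronwall_step\<close>) then gives the
  bound \<open>C \<tau>\<^sup>2\<close>.

  Existence of the numerical solutions is part of the claim. The linearly implicit step is a resolvent
  equation with bounded perturbation, after conjugation by \<open>S\<close> (\<open>resolvent_solvable_Y\<close>). The fully implicit
  step is a fixed point of a map that preserves a ball of \<open>Y\<close> and contracts distances measured in \<open>X\<close>
  (\<open>implicit_step_solvable\<close>); balls of \<open>Y\<close> are closed in \<open>X\<close> (\<open>closed_image_cball\<close>). In both cases the error bound
  keeps the numerical solution in a fixed ball, so that the construction reaches the end of \<open>[0, T]\<close>.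
\<close>

section \<open>Taylor remainders on an interval\<close>

lemma vector_mean_value_bound:
  fixes g :: "real \<Rightarrow> 'a::real_normed_vector"
  assumes "convex I" "\<And>x. x \<in> I \<Longrightarrow> (g has_vector_derivative g1 x) (at x within I)"
    and "\<And>x. x \<in> I \<Longrightarrow> norm (g1 x) \<le> K" "s \<in> I" "t \<in> I"
  shows "norm (g s - g t) \<le> K * \<bar>s - t\<bar>"
proof -
  have "norm (g s - g t) \<le> K * norm (s - t)"
  proof (rule differentiable_bound[where f' = "\<lambda>x h. h *\<^sub>R g1 x"])
    show "onorm (\<lambda>h. h *\<^sub>R g1 x) \<le> K" if "x \<in> I" for x
      by (rule onorm_le) (use mult_left_mono[OF assms(3)[OF that] abs_ge_zero] in \<open>simp add: mult.commute\<close>)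
  qed (use assms in \<open>auto simp: has_vector_derivative_def\<close>)
  then show ?thesis by simp
qed

text \<open>
  The linearized mean value inequality along the segment from \<open>t\<close> to \<open>s\<close>, where the first derivative
  varies by at most \<open>K\<close> times the length of the segment.
\<close>

lemma first_order_remainder:
  fixes g :: "real \<Rightarrow> 'a::real_normed_vector"
  assumes I: "convex I"
    and g: "\<And>x. x \<in> I \<Longrightarrow> (g has_vector_derivative g1 x) (at x within I)"
    and g1: "\<And>x. x \<in> I \<Longrightarrow> (g1 has_vector_derivative g2 x) (at x within I)"
    and K: "\<And>x. x \<in> I \<Longrightarrow> norm (g2 x) \<le> K" and s: "s \<in> I" and t: "t \<in> I"
  shows "norm (g s - g t - (s - t) *\<^sub>R g1 t) \<le> K * (s - t)\<^sup>2"
proof -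
  let ?J = "closed_segment t s"
  have sub: "?J \<subseteq> I" using I s t by (simp add: closed_segment_subset)
  have K0: "0 \<le> K" using K[OF s] norm_ge_zero order_trans by blast
  have "norm (g s - g t - (s - t) *\<^sub>R g1 t) \<le> norm (s - t) * (K * \<bar>s - t\<bar>)"
  proof (rule vector_differentiable_bound_linearization)
    fix x assume x: "x \<in> ?J"
    show "(g has_vector_derivative g1 x) (at x within ?J)"
      using g x sub by (meson has_vector_derivative_within_subset subsetD)
    have "norm (g1 x - g1 t) \<le> K * \<bar>x - t\<bar>"
      by (rule vector_mean_value_bound[OF I g1 K]) (use x sub t in auto)
    also have "\<dots> \<le> K * \<bar>s - t\<bar>"
      using x K0 by (intro mult_left_mono) (auto simp: closed_segment_eq_real_ivl split: if_splits)
    finally show "norm (g1 x - g1 t) \<le> K * \<bar>s - t\<bar>" .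
  qed auto
  then show ?thesis by (simp add: power2_eq_square algebra_simps flip: abs_mult)
qed

text \<open>
  After subtraction of the quadratic term, the derivative of the remaining function differs from its
  value at \<open>t\<close> by the first-order remainder of \<open>g1\<close>, which is quadratically small.
\<close>

lemma second_order_remainder:
  fixes g :: "real \<Rightarrow> 'a::real_normed_vector"
  assumes I: "convex I"
    and g: "\<And>x. x \<in> I \<Longrightarrow> (g has_vector_derivative g1 x) (at x within I)"
    and g1: "\<And>x. x \<in> I \<Longrightarrow> (g1 has_vector_derivative g2 x) (at x within I)"
    and g2: "\<And>x. x \<in> I \<Longrightarrow> (g2 has_vector_derivative g3 x) (at x within I)"
    and K: "\<And>x. x \<in> I \<Longrightarrow> norm (g3 x) \<le> K" and s: "s \<in> I" and t: "t \<in> I"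
  shows "norm (g s - g t - (s - t) *\<^sub>R g1 t - ((s - t)\<^sup>2 / 2) *\<^sub>R g2 t) \<le> K * \<bar>s - t\<bar> ^ 3"
proof -
  let ?J = "closed_segment t s"
  have sub: "?J \<subseteq> I" using I s t by (simp add: closed_segment_subset)
  have K0: "0 \<le> K" using K[OF s] norm_ge_zero order_trans by blast
  define h where "h x = g x - ((x - t)\<^sup>2 / 2) *\<^sub>R g2 t" for x
  define h1 where "h1 x = g1 x - (x - t) *\<^sub>R g2 t" for x
  have "norm (h s - h t - (s - t) *\<^sub>R h1 t) \<le> norm (s - t) * (K * (s - t)\<^sup>2)"
  proof (rule vector_differentiable_bound_linearization)
    fix x assume x: "x \<in> ?J"
    have "(g has_vector_derivative g1 x) (at x within ?J)"
      using g x sub by (meson has_vector_derivative_within_subset subsetD)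
    then show "(h has_vector_derivative h1 x) (at x within ?J)"
      unfolding h_def h1_def
      by (auto intro!: derivative_eq_intros simp: has_vector_derivative_def scaleR_diff_right)
    have "norm (g1 x - g1 t - (x - t) *\<^sub>R g2 t) \<le> K * (x - t)\<^sup>2"
      by (rule first_order_remainder[OF I g1 g2 K]) (use x sub t in auto)
    also have "\<dots> \<le> K * (s - t)\<^sup>2"
      using x K0
      by (intro mult_left_mono) (auto simp: closed_segment_eq_real_ivl abs_le_square_iff[symmetric] split: if_splits)
    finally show "norm (h1 x - h1 t) \<le> K * (s - t)\<^sup>2"
      by (simp add: h1_def algebra_simps)
  qed auto
  also have "norm (s - t) * (K * (s - t)\<^sup>2) = K * \<bar>s - t\<bar> ^ 3"
    by (simp add: power3_eq_cube power2_eq_square)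
  finally show ?thesis by (simp add: h_def h1_def algebra_simps)
qed

lemma Ck_on_imp_continuous_on: "Ck_on k I g \<Longrightarrow> continuous_on I g"
  by (cases k) (auto intro: continuous_on_vector_derivative)

lemma continuous_on_norm_bound:
  fixes g :: "real \<Rightarrow> 'a::real_normed_vector"
  assumes "continuous_on {0..T} g"
  obtains K where "0 \<le> K" "\<And>t. t \<in> {0..T} \<Longrightarrow> norm (g t) \<le> K"
proof -
  have "bounded (g ` {0..T})"
    using assms compact_continuous_image compact_imp_bounded by blast
  then obtain K where "\<forall>y\<in>g ` {0..T}. norm y \<le> K" by (auto simp: bounded_iff)
  then show thesis by (intro that[of "max 0 K"]) (auto simp: le_max_iff_disj)
qed

section \<open>Consistency of the midpoint formulas\<close>

text \<open>
  Second-order accuracy comes from symmetry: in the difference of the Taylor expansions at the two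
  end points about the midpoint the quadratic terms cancel.
\<close>

lemma difference_quotient_at_midpoint:
  fixes g :: "real \<Rightarrow> 'a::real_normed_vector"
  assumes "Ck_on 3 {0..T} g"
  obtains g1 K where "0 \<le> K"
    and "\<And>t. t \<in> {0..T} \<Longrightarrow> (g has_vector_derivative g1 t) (at t within {0..T})"
    and "\<And>t \<tau>. \<lbrakk>0 \<le> t; 0 < \<tau>; t + \<tau> \<le> T\<rbrakk> \<Longrightarrow>
           norm (g1 (t + \<tau> / 2) - (1 / \<tau>) *\<^sub>R (g (t + \<tau>) - g t)) \<le> K * \<tau>\<^sup>2"
proof -
  obtain g1 where g1: "\<And>t. t \<in> {0..T} \<Longrightarrow> (g has_vector_derivative g1 t) (at t within {0..T})"
      "Ck_on 2 {0..T} g1"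
    using assms unfolding numeral_3_eq_3 numeral_2_eq_2 Ck_on.simps(2)[of "Suc (Suc 0)"] by blast
  obtain g2 where g2: "\<And>t. t \<in> {0..T} \<Longrightarrow> (g1 has_vector_derivative g2 t) (at t within {0..T})"
      "Ck_on 1 {0..T} g2"
    using g1(2) unfolding numeral_2_eq_2 One_nat_def Ck_on.simps(2)[of "Suc 0"] by blast
  obtain g3 where g3: "\<And>t. t \<in> {0..T} \<Longrightarrow> (g2 has_vector_derivative g3 t) (at t within {0..T})"
      "Ck_on 0 {0..T} g3"
    using g2(2) unfolding One_nat_def Ck_on.simps(2)[of 0] by blast
  obtain K where K: "0 \<le> K" "\<And>t. t \<in> {0..T} \<Longrightarrow> norm (g3 t) \<le> K"
    using continuous_on_norm_bound g3(2) by (metis Ck_on.simps(1))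
  show thesis
  proof (rule that[OF K(1) g1(1)])
    fix t \<tau> :: real assume t: "0 \<le> t" "0 < \<tau>" "t + \<tau> \<le> T"
    define c where "c = t + \<tau> / 2"
    have R: "norm (g s - g c - (s - c) *\<^sub>R g1 c - ((s - c)\<^sup>2 / 2) *\<^sub>R g2 c) \<le> K * \<bar>s - c\<bar> ^ 3"
      if "s \<in> {0..T}" for s
      by (rule second_order_remainder[OF _ g1(1) g2(1) g3(1) K(2)]) (use that t in \<open>auto simp: c_def\<close>)
    let ?r = "\<lambda>s. g s - g c - (s - c) *\<^sub>R g1 c - ((s - c)\<^sup>2 / 2) *\<^sub>R g2 c"
    have "g1 c - (1 / \<tau>) *\<^sub>R (g (t + \<tau>) - g t) = (1 / \<tau>) *\<^sub>R (?r t - ?r (t + \<tau>))"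
    proof -
      have "?r t - ?r (t + \<tau>) = \<tau> *\<^sub>R g1 c - (g (t + \<tau>) - g t)"
      proof -
        have e: "t - c = - (\<tau> / 2)" "t + \<tau> - c = \<tau> / 2" by (auto simp: c_def)
        have "\<tau> *\<^sub>R g1 c = (\<tau> / 2) *\<^sub>R g1 c + (\<tau> / 2) *\<^sub>R g1 c"
          by (simp flip: scaleR_add_left)
        then show ?thesis unfolding e by simp
      qed
      then have "(1 / \<tau>) *\<^sub>R (?r t - ?r (t + \<tau>))
          = (1 / \<tau>) *\<^sub>R (\<tau> *\<^sub>R g1 c - (g (t + \<tau>) - g t))" by (rule arg_cong)
      then show ?thesis using t by (simp add: scaleR_diff_right)
    qed
    also have "norm \<dots> = (1 / \<tau>) * norm (?r t - ?r (t + \<tau>))" using t by simp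
    also have "\<dots> \<le> (1 / \<tau>) * (K * \<bar>t - c\<bar> ^ 3 + K * \<bar>t + \<tau> - c\<bar> ^ 3)"
      using t by (intro mult_left_mono order_trans[OF norm_triangle_ineq4] add_mono R) auto
    also have "\<dots> = K * \<tau>\<^sup>2 / 4"
      using t by (simp add: c_def power3_eq_cube power2_eq_square)
    also have "\<dots> \<le> K * \<tau>\<^sup>2" using K(1) by simp
    finally show "norm (g1 (t + \<tau> / 2) - (1 / \<tau>) *\<^sub>R (g (t + \<tau>) - g t)) \<le> K * \<tau>\<^sup>2"
      by (simp add: c_def)
  qed
qed

text \<open>
  An affine combination of values of \<open>g\<close> whose nodes average to \<open>c\<close> annihilates the linear part
  of the Taylor expansion at \<open>c\<close>. The average and the extrapolation are such combinations.
\<close>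

lemma affine_combination_at_midpoint:
  fixes g :: "real \<Rightarrow> 'a::real_normed_vector"
  assumes "Ck_on 2 {0..T} g"
  obtains K where "0 \<le> K"
    and "\<And>\<alpha> \<beta> r s c. \<lbrakk>r \<in> {0..T}; s \<in> {0..T}; c \<in> {0..T}; \<alpha> + \<beta> = 1; \<alpha> * r + \<beta> * s = c\<rbrakk> \<Longrightarrow>
           norm (\<alpha> *\<^sub>R g r + \<beta> *\<^sub>R g s - g c) \<le> K * (\<bar>\<alpha>\<bar> * (r - c)\<^sup>2 + \<bar>\<beta>\<bar> * (s - c)\<^sup>2)"
proof -
  obtain g1 where g1: "\<And>t. t \<in> {0..T} \<Longrightarrow> (g has_vector_derivative g1 t) (at t within {0..T})"
      "Ck_on 1 {0..T} g1"
    using assms unfolding numeral_2_eq_2 One_nat_def Ck_on.simps(2)[of "Suc 0"] by blast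
  obtain g2 where g2: "\<And>t. t \<in> {0..T} \<Longrightarrow> (g1 has_vector_derivative g2 t) (at t within {0..T})"
      "Ck_on 0 {0..T} g2"
    using g1(2) unfolding One_nat_def Ck_on.simps(2)[of 0] by blast
  obtain K where K: "0 \<le> K" "\<And>t. t \<in> {0..T} \<Longrightarrow> norm (g2 t) \<le> K"
    using continuous_on_norm_bound g2(2) by (metis Ck_on.simps(1))
  show thesis
  proof (rule that[OF K(1)])
    fix \<alpha> \<beta> r s c :: real
    assume i: "r \<in> {0..T}" "s \<in> {0..T}" and c: "c \<in> {0..T}" "\<alpha> + \<beta> = 1" "\<alpha> * r + \<beta> * s = c"
    let ?r = "\<lambda>s. g s - g c - (s - c) *\<^sub>R g1 c"
    have R: "norm (?r s) \<le> K * (s - c)\<^sup>2" if "s \<in> {0..T}" for s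
      by (rule first_order_remainder[OF _ g1(1) g2(1) K(2)]) (use that c in auto)
    have "\<alpha> *\<^sub>R ?r r + \<beta> *\<^sub>R ?r s
        = \<alpha> *\<^sub>R g r + \<beta> *\<^sub>R g s - (\<alpha> + \<beta>) *\<^sub>R g c - (\<alpha> * (r - c) + \<beta> * (s - c)) *\<^sub>R g1 c"
      by (simp add: algebra_simps)
    also have "\<alpha> * (r - c) + \<beta> * (s - c) = (\<alpha> * r + \<beta> * s) - (\<alpha> + \<beta>) * c"
      by (simp add: algebra_simps)
    also have "\<dots> = 0" using c by simp
    finally have "norm (\<alpha> *\<^sub>R g r + \<beta> *\<^sub>R g s - g c) = norm (\<alpha> *\<^sub>R ?r r + \<beta> *\<^sub>R ?r s)"
      using c by simp
    also have "\<dots> \<le> \<bar>\<alpha>\<bar> * (K * (r - c)\<^sup>2) + \<bar>\<beta>\<bar> * (K * (s - c)\<^sup>2)"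
      by (intro order_trans[OF norm_triangle_ineq] add_mono) (auto intro!: mult_left_mono R i)
    finally show "norm (\<alpha> *\<^sub>R g r + \<beta> *\<^sub>R g s - g c) \<le> K * (\<bar>\<alpha>\<bar> * (r - c)\<^sup>2 + \<bar>\<beta>\<bar> * (s - c)\<^sup>2)"
      by (simp add: algebra_simps)
  qed
qed

lemma average_at_midpoint:
  fixes g :: "real \<Rightarrow> 'a::real_normed_vector"
  assumes "Ck_on 2 {0..T} g"
  obtains K where "0 \<le> K"
    and "\<And>t \<tau>. \<lbrakk>0 \<le> t; 0 < \<tau>; t + \<tau> \<le> T\<rbrakk> \<Longrightarrow>
           norm ((1/2) *\<^sub>R (g (t + \<tau>) + g t) - g (t + \<tau> / 2)) \<le> K * \<tau>\<^sup>2"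
proof -
  obtain K where K: "0 \<le> K" "\<And>\<alpha> \<beta> r s c. \<lbrakk>r \<in> {0..T}; s \<in> {0..T}; c \<in> {0..T}; \<alpha> + \<beta> = 1; \<alpha> * r + \<beta> * s = c\<rbrakk> \<Longrightarrow>
           norm (\<alpha> *\<^sub>R g r + \<beta> *\<^sub>R g s - g c) \<le> K * (\<bar>\<alpha>\<bar> * (r - c)\<^sup>2 + \<bar>\<beta>\<bar> * (s - c)\<^sup>2)"
    using affine_combination_at_midpoint[OF assms] by blast
  show thesis
  proof (rule that[OF K(1)])
    fix t \<tau> :: real assume t: "0 \<le> t" "0 < \<tau>" "t + \<tau> \<le> T"
    have "norm ((1/2) *\<^sub>R g (t + \<tau>) + (1/2) *\<^sub>R g t - g (t + \<tau> / 2))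
        \<le> K * (\<bar>1/2\<bar> * (t + \<tau> - (t + \<tau> / 2))\<^sup>2 + \<bar>1/2\<bar> * (t - (t + \<tau> / 2))\<^sup>2)"
      by (rule K(2)) (use t in \<open>auto simp: field_simps\<close>)
    also have "\<dots> = K * \<tau>\<^sup>2 / 4" by (simp add: power2_eq_square)
    also have "\<dots> \<le> K * \<tau>\<^sup>2" using K(1) by simp
    finally show "norm ((1/2) *\<^sub>R (g (t + \<tau>) + g t) - g (t + \<tau> / 2)) \<le> K * \<tau>\<^sup>2"
      by (simp add: scaleR_add_right)
  qed
qed

lemma extrapolation_at_midpoint:
  fixes g :: "real \<Rightarrow> 'a::real_normed_vector"
  assumes "Ck_on 2 {0..T} g"
  obtains K where "0 \<le> K"
    and "\<And>t \<tau>. \<lbrakk>\<tau> \<le> t; 0 < \<tau>; t + \<tau> \<le> T\<rbrakk> \<Longrightarrow>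
           norm (g t + (1/2) *\<^sub>R (g t - g (t - \<tau>)) - g (t + \<tau> / 2)) \<le> K * \<tau>\<^sup>2"
proof -
  obtain K where K: "0 \<le> K" "\<And>\<alpha> \<beta> r s c. \<lbrakk>r \<in> {0..T}; s \<in> {0..T}; c \<in> {0..T}; \<alpha> + \<beta> = 1; \<alpha> * r + \<beta> * s = c\<rbrakk> \<Longrightarrow>
           norm (\<alpha> *\<^sub>R g r + \<beta> *\<^sub>R g s - g c) \<le> K * (\<bar>\<alpha>\<bar> * (r - c)\<^sup>2 + \<bar>\<beta>\<bar> * (s - c)\<^sup>2)"
    using affine_combination_at_midpoint[OF assms] by blast
  show thesis
  proof (rule that[of "2 * K"])
    fix t \<tau> :: real assume t: "\<tau> \<le> t" "0 < \<tau>" "t + \<tau> \<le> T"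
    have "(3/2) * t + (-1/2) * (t - \<tau>) = t + \<tau> / 2" by (simp add: field_simps)
    then have "norm ((3/2) *\<^sub>R g t + (-1/2) *\<^sub>R g (t - \<tau>) - g (t + \<tau> / 2))
        \<le> K * (\<bar>3/2\<bar> * (t - (t + \<tau> / 2))\<^sup>2 + \<bar>-1/2\<bar> * (t - \<tau> - (t + \<tau> / 2))\<^sup>2)"
      using t by (intro K(2)) auto
    also have "\<dots> = (3/2) * K * \<tau>\<^sup>2" by (simp add: power2_eq_square field_simps)
    also have "\<dots> \<le> 2 * K * \<tau>\<^sup>2" using K(1) by (intro mult_right_mono) auto
    also have "(3/2) *\<^sub>R g t + (-1/2) *\<^sub>R g (t - \<tau>) = g t + (1/2) *\<^sub>R (g t - g (t - \<tau>))"
    proof -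
      have "(3/2) *\<^sub>R g t = (1 + 1/2) *\<^sub>R g t" by simp
      also have "\<dots> = g t + (1/2) *\<^sub>R g t" by (simp only: scaleR_add_left scaleR_one)
      finally show ?thesis by (simp add: scaleR_diff_right)
    qed
    finally show "norm (g t + (1/2) *\<^sub>R (g t - g (t - \<tau>)) - g (t + \<tau> / 2)) \<le> 2 * K * \<tau>\<^sup>2" .
  qed (use K(1) in simp)
qed

lemma Ck_on_Lipschitz:
  fixes g :: "real \<Rightarrow> 'a::real_normed_vector"
  assumes "Ck_on (Suc k) {0..T} g"
  obtains K where "0 \<le> K"
    and "\<And>s t. \<lbrakk>s \<in> {0..T}; t \<in> {0..T}\<rbrakk> \<Longrightarrow> norm (g s - g t) \<le> K * \<bar>s - t\<bar>"
proof -
  obtain g' where g': "\<And>t. t \<in> {0..T} \<Longrightarrow> (g has_vector_derivative g' t) (at t within {0..T})" "Ck_on k {0..T} g'"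
    using assms unfolding Ck_on.simps(2) by blast
  obtain K where "0 \<le> K" "\<And>t. t \<in> {0..T} \<Longrightarrow> norm (g' t) \<le> K"
    using continuous_on_norm_bound Ck_on_imp_continuous_on[OF g'(2)] by metis
  then show thesis using vector_mean_value_bound[OF _ g'(1)] that by (metis convex_real_interval(5))
qed

section \<open>Bounded closed convex sets in a Hilbert space\<close>

text \<open>
  A substitute for weak compactness. The infima \<open>q\<close> of the squared norm on the sets increase and are
  bounded, hence converge. By convexity the midpoint of two almost minimal points still has a squared
  norm of at least \<open>q\<close>, so the parallelogram identity makes almost minimal points a Cauchy sequence.
\<close>

lemma nested_closed_convex_Inter_nonempty:
  fixes F :: "nat \<Rightarrow> 'a::{real_inner,complete_space} set"
  assumes cvx: "\<And>n. convex (F n)" and clo: "\<And>n. closed (F n)" and ne: "\<And>n. F n \<noteq> {}"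
    and dec: "decseq F" and bd: "\<And>y. y \<in> F 0 \<Longrightarrow> norm y \<le> r"
  shows "(\<Inter>n. F n) \<noteq> {}"
proof -
  define q where "q n = (INF y\<in>F n. (norm y)\<^sup>2)" for n
  have sub: "F m \<subseteq> F n" if "n \<le> m" for m n using dec that by (simp add: decseq_def)
  have below: "bdd_below ((\<lambda>y. (norm y)\<^sup>2) ` F n)" for n by (rule bdd_belowI2[where m = 0]) simp
  have q_le: "q n \<le> (norm y)\<^sup>2" if "y \<in> F n" for n y
    unfolding q_def using below that by (rule cINF_lower)
  have "incseq q" unfolding incseq_def
  proof (intro allI impI)
    fix n m :: nat assume "n \<le> m"
    then show "q n \<le> q m"
      unfolding q_def[of m] by (intro cINF_greatest ne q_le) (use sub in blast)
  qed
  moreover have "q n \<le> r\<^sup>2" for n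
  proof -
    obtain y where y: "y \<in> F n" using ne by blast
    then have "norm y \<le> r" using bd sub[of 0 n] by blast
    then show ?thesis using q_le[OF y] by (meson norm_ge_zero order_trans power_mono)
  qed
  ultimately have "convergent q" by (meson incseq_convergent convergentI)
  then have Cq: "Cauchy q" by (rule convergent_Cauchy)
  have "\<exists>y. y \<in> F n \<and> (norm y)\<^sup>2 < q n + inverse (real (Suc n))" for n
  proof -
    have "(INF y\<in>F n. (norm y)\<^sup>2) < q n + inverse (real (Suc n))" by (simp add: q_def)
    then show ?thesis using cINF_less_iff[OF ne below] by (simp only: Bex_def)
  qed
  then obtain y where y: "\<And>n. y n \<in> F n" "\<And>n. (norm (y n))\<^sup>2 < q n + inverse (real (Suc n))"
    by metis
  have par: "(norm (y m - y n))\<^sup>2 \<le> 2 * (q m - q n) + 4 * inverse (real (Suc n))" if "n \<le> m" for m n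
  proof -
    let ?c = "(1/2) *\<^sub>R y m + (1/2) *\<^sub>R y n"
    have "?c \<in> F n" using y(1) sub[OF that] by (intro convexD[OF cvx]) auto
    then have "q n \<le> (norm ?c)\<^sup>2" by (rule q_le)
    moreover have "(norm (y m - y n))\<^sup>2 + 4 * (norm ?c)\<^sup>2 = 2 * (norm (y m))\<^sup>2 + 2 * (norm (y n))\<^sup>2"
      by (simp add: power2_norm_eq_inner algebra_simps inner_commute)
    moreover have "inverse (real (Suc m)) \<le> inverse (real (Suc n))"
      using that by (intro le_imp_inverse_le) auto
    ultimately show ?thesis
      using y(2)[of m] y(2)[of n] by (smt (verit, ccfv_SIG))
  qed
  have "Cauchy y"
  proof (rule CauchyI')
    fix e :: real assume e: "0 < e"
    obtain N1 where N1: "\<And>m n. \<lbrakk>m \<ge> N1; n \<ge> N1\<rbrakk> \<Longrightarrow> norm (q m - q n) < e\<^sup>2 / 4"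
      using Cq e unfolding Cauchy_iff by (metis zero_less_divide_iff zero_less_numeral zero_less_power)
    obtain N2 where N2: "inverse (real (Suc N2)) < e\<^sup>2 / 8"
      using reals_Archimedean[of "e\<^sup>2 / 8"] e by auto
    show "\<exists>M. \<forall>m\<ge>M. \<forall>n>m. dist (y m) (y n) < e"
    proof (intro exI allI impI)
      fix n m assume n: "max N1 N2 \<le> n" "n < m"
      have "inverse (real (Suc n)) \<le> inverse (real (Suc N2))"
        using n by (intro le_imp_inverse_le) auto
      then have "inverse (real (Suc n)) < e\<^sup>2 / 8" using N2 by (rule order_le_less_trans)
      moreover have "q m - q n < e\<^sup>2 / 4" using N1[of m n] n abs_ge_self[of "q m - q n"]
        unfolding real_norm_def by (metis less_imp_le max.bounded_iff order.strict_trans1 order_trans)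
      moreover have "(norm (y m - y n))\<^sup>2 \<le> 2 * (q m - q n) + 4 * inverse (real (Suc n))"
        using par n by simp
      moreover have "x < E" if "i < E / 8" "d < E / 4" "x \<le> 2 * d + 4 * i" for x d i E :: real
        using that by linarith
      ultimately have "(norm (y m - y n))\<^sup>2 < e\<^sup>2" by metis
      then show "dist (y n) (y m) < e"
        using e by (simp add: dist_norm norm_minus_commute power2_less_imp_less)
    qed
  qed
  then obtain l where l: "y \<longlonglongrightarrow> l" using Cauchy_convergent convergent_def by blast
  have "l \<in> F n" for n
    by (rule Lim_in_closed_set[OF clo _ _ l])
       (auto simp: eventually_sequentially intro!: exI[of _ n] dest: sub intro: y(1) subsetD[OF sub])
  then show ?thesis by blast
qed

text \<open>
  For an embedding of \<open>Y\<close> in \<open>X\<close> this says that balls of \<open>Y\<close> are closed in the weaker norm of \<open>X\<close>.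
  A limit \<open>l\<close> is attained because the points of the ball whose images are \<open>1 / (n + 1)\<close>-close to \<open>l\<close>
  form a decreasing sequence of closed convex sets.
\<close>

lemma closed_image_cball:
  fixes h :: "'a::{real_inner,complete_space} \<Rightarrow> 'b::real_normed_vector"
  assumes h: "bounded_linear h"
  shows "closed (h ` cball 0 r)"
proof -
  interpret h: bounded_linear h by (rule h)
  show ?thesis unfolding closed_sequential_limits
  proof (intro allI impI)
    fix z l assume "(\<forall>n. z n \<in> h ` cball 0 r) \<and> z \<longlonglongrightarrow> l"
    then have z: "\<And>n. z n \<in> h ` cball 0 r" "z \<longlonglongrightarrow> l" by auto
    define F where "F n = cball 0 r \<inter> h -` cball l (inverse (real (Suc n)))" for n
    have "(\<Inter>n. F n) \<noteq> {}"
    proof (rule nested_closed_convex_Inter_nonempty)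
      show "convex (F n)" for n unfolding F_def
        by (intro convex_Int convex_cball convex_linear_vimage h.linear_axioms)
      show "closed (F n)" for n unfolding F_def
        by (intro closed_Int closed_cball closed_vimage h.continuous_on continuous_on_id)
      show "F n \<noteq> {}" for n
      proof -
        have "\<forall>\<^sub>F k in sequentially. dist (z k) l < inverse (real (Suc n))"
          using z(2) by (rule tendstoD) simp
        then obtain k where k: "dist (z k) l < inverse (real (Suc n))"
          by (auto dest: eventually_happens)
        obtain w where "w \<in> cball 0 r" "z k = h w" using z(1) by blast
        with k have "w \<in> F n" unfolding F_def by (simp add: dist_commute)
        then show ?thesis by blast
      qed
      show "decseq F" unfolding decseq_def F_def
        by (auto elim!: order_trans simp del: of_nat_Suc intro!: le_imp_inverse_le)
      show "norm y \<le> r" if "y \<in> F 0" for y using that by (simp add: F_def)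
    qed
    then obtain y where y: "\<And>n. y \<in> F n" by blast
    have "dist l (h y) \<le> 0"
    proof (rule ccontr)
      assume "\<not> dist l (h y) \<le> 0"
      then obtain n where "inverse (real (Suc n)) < dist l (h y)"
        using reals_Archimedean[of "dist l (h y)"] by (auto simp del: of_nat_Suc)
      with y[of n] show False by (simp add: F_def del: of_nat_Suc)
    qed
    then show "l \<in> h ` cball 0 r" using y[of 0] by (auto simp: F_def)
  qed
qed

section \<open>Operators of Kato type\<close>

locale kato_operators =
  fixes j :: "'y::{real_inner,complete_space} \<Rightarrow> 'x::{real_inner,complete_space}"
    and D :: "'y \<Rightarrow> 'x set" and A B :: "'y \<Rightarrow> 'x \<Rightarrow> 'x" and S :: "'y \<Rightarrow> 'x" and f :: "'x \<Rightarrow> 'x"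
    and MA MB LA LB lX lY :: "real \<Rightarrow> real"
  assumes embedding: "dense_embedding j"
    and K1: "kato_K1 j D A MA"
    and K2: "kato_K2 j D A S B MB"
    and K3: "kato_K3 j A B LA LB"
    and K4: "kato_K4 j f lX lY"
begin

lemma norm_j_le: "norm (j y) \<le> norm y"
  using embedding by (simp add: dense_embedding_def)

lemma bounded_linear_j: "bounded_linear j"
  using embedding norm_j_le
  by (auto simp: dense_embedding_def linear_iff intro!: bounded_linear_intro[where K = 1])

sublocale j: bounded_linear j by (rule bounded_linear_j)

lemma inj_j: "j a = j b \<longleftrightarrow> a = b"
  using embedding by (auto simp: dense_embedding_def inj_def)

lemma norm_S: "norm (S w) = norm w"
  using K2 by (simp add: kato_K2_def)

lemma bounded_linear_S: "bounded_linear S"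
  using K2 by (auto simp: kato_K2_def linear_iff intro!: bounded_linear_intro[where K = 1])

sublocale S: bounded_linear S by (rule bounded_linear_S)

lemma inj_S: "S a = S b \<longleftrightarrow> a = b"
  by (metis S.diff eq_iff_diff_eq_0 norm_S norm_eq_zero)

lemma j_in_D: "j w \<in> D y"
  using K1 unfolding kato_K1_def by blast

lemma monotone_A: "w \<in> D y \<Longrightarrow> 0 \<le> inner w (A y w)"
  using K1 by (auto simp: kato_K1_def)

lemma subspace_graph: "subspace (op_graph (D y) (A y))"
  using K1 by (auto simp: kato_K1_def closed_linear_operator_def)

lemma add_A: "v \<in> D y \<Longrightarrow> w \<in> D y \<Longrightarrow> v + w \<in> D y \<and> A y (v + w) = A y v + A y w"
  using subspace_add[OF subspace_graph, of "(v, A y v)" y "(w, A y w)"]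
  by (auto simp: op_graph_def)

lemma scaleR_A: "v \<in> D y \<Longrightarrow> c *\<^sub>R v \<in> D y \<and> A y (c *\<^sub>R v) = c *\<^sub>R A y v"
  using subspace_scale[OF subspace_graph, of "(v, A y v)" y c]
  by (auto simp: op_graph_def)

lemma diff_A: "v \<in> D y \<Longrightarrow> w \<in> D y \<Longrightarrow> v - w \<in> D y \<and> A y (v - w) = A y v - A y w"
  using add_A[of v y "(-1) *\<^sub>R w"] scaleR_A[of w y "-1"] by simp

lemma linear_B: "linear (B y)"
proof -
  have "0 < norm y + 1" "norm y \<le> norm y + 1" using norm_ge_zero[of y] by linarith+
  then show ?thesis using K2 unfolding kato_K2_def Let_def by blast
qed

text \<open>
  Nothing prevents the constants of (K1)--(K4) from being negative on trivial spaces. Absolute values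
  make the bounds monotone in the norms that they contain.
\<close>

lemma norm_A_le: "0 < R \<Longrightarrow> norm y \<le> R \<Longrightarrow> norm (A y (j w)) \<le> \<bar>MA R\<bar> * norm w"
  using K1 unfolding kato_K1_def
  by (meson abs_ge_self mult_right_mono norm_ge_zero order_trans)

lemma norm_B_le: "0 < R \<Longrightarrow> norm y \<le> R \<Longrightarrow> norm (B y x) \<le> \<bar>MB R\<bar> * norm x"
  using K2 unfolding kato_K2_def Let_def
  by (meson abs_ge_self mult_right_mono norm_ge_zero order_trans)

lemma A_Lipschitz:
  "0 < R \<Longrightarrow> norm y \<le> R \<Longrightarrow> norm y' \<le> R \<Longrightarrow>
   norm (A y (j w) - A y' (j w)) \<le> \<bar>LA R\<bar> * norm (j y - j y') * norm w"
  using K3 unfolding kato_K3_def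
  by (meson abs_ge_self mult_right_mono norm_ge_zero order_trans)

lemma B_Lipschitz:
  "0 < R \<Longrightarrow> norm y \<le> R \<Longrightarrow> norm y' \<le> R \<Longrightarrow>
   norm (B y x - B y' x) \<le> \<bar>LB R\<bar> * norm (y - y') * norm x"
  using K3 unfolding kato_K3_def
  by (meson abs_ge_self mult_right_mono norm_ge_zero order_trans)

lemma f_Lipschitz_X:
  "0 < R \<Longrightarrow> norm y \<le> R \<Longrightarrow> norm y' \<le> R \<Longrightarrow>
   norm (f (j y) - f (j y')) \<le> \<bar>lX R\<bar> * norm (j y - j y')"
  using K4 unfolding kato_K4_def
  by (meson abs_ge_self mult_right_mono norm_ge_zero order_trans)

lemma f_diff_in_Y: "\<exists>d. j d = f (j y) - f (j y')"
proof -
  have "0 < norm y + norm y' + 1" "norm y \<le> norm y + norm y' + 1" "norm y' \<le> norm y + norm y' + 1"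
    using norm_ge_zero[of y] norm_ge_zero[of y'] by linarith+
  then show ?thesis using K4 unfolding kato_K4_def by blast
qed

lemma f_Lipschitz_Y:
  assumes "0 < R" "norm y \<le> R" "norm y' \<le> R" "j a = f (j y)" "j b = f (j y')"
  shows "norm (a - b) \<le> \<bar>lY R\<bar> * norm (y - y')"
proof -
  obtain d where d: "j d = f (j y) - f (j y')" "norm d \<le> lY R * norm (y - y')"
    using K4 assms(1-3) unfolding kato_K4_def by blast
  have "d = a - b" using d(1) assms(4,5) by (metis inj_j j.diff)
  moreover have "lY R * norm (y - y') \<le> \<bar>lY R\<bar> * norm (y - y')" by (simp add: mult_right_mono)
  ultimately show ?thesis using d(2) by simp
qed

subsection \<open>The conjugation identity\<close>

text \<open>
  The operator identity of (K2) without relational composition: its left-hand side describes the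
  elements of \<open>Y\<close> that \<open>A y\<close> maps into \<open>Y\<close>.
\<close>

lemma conjugation_graph:
  "(\<exists>w z. p = S w \<and> q = S z \<and> A y (j w) = j z) \<longleftrightarrow> p \<in> D y \<and> q = A y p + B y p"
proof -
  let ?G = "range (\<lambda>w. (j w, S w))"
  have "0 < norm y + 1" "norm y \<le> norm y + 1" using norm_ge_zero[of y] by linarith+
  then have "?G\<inverse> O op_graph (D y) (A y) O ?G = op_graph (D y) (\<lambda>v. A y v + B y v)"
    using K2 unfolding kato_K2_def Let_def by blast
  moreover have "(p, q) \<in> ?G\<inverse> O op_graph (D y) (A y) O ?G \<longleftrightarrow>
      (\<exists>w z. p = S w \<and> q = S z \<and> A y (j w) = j z)"
  proof
    assume "(p, q) \<in> ?G\<inverse> O op_graph (D y) (A y) O ?G"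
    then show "\<exists>w z. p = S w \<and> q = S z \<and> A y (j w) = j z"
      by (auto simp: op_graph_def relcomp_unfold)
  next
    assume "\<exists>w z. p = S w \<and> q = S z \<and> A y (j w) = j z"
    then obtain w z where w: "p = S w" "q = S z" "A y (j w) = j z" by blast
    have "(p, j w) \<in> ?G\<inverse>" "(j w, j z) \<in> op_graph (D y) (A y)" "(j z, q) \<in> ?G"
      using w j_in_D[of w y] by (auto simp: op_graph_def)
    then show "(p, q) \<in> ?G\<inverse> O op_graph (D y) (A y) O ?G" by (meson relcompI)
  qed
  moreover have "(p, q) \<in> op_graph (D y) (\<lambda>v. A y v + B y v) \<longleftrightarrow> p \<in> D y \<and> q = A y p + B y p"
    by (auto simp: op_graph_def)
  ultimately show ?thesis by simp
qed

lemma S_A_eq: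
  assumes "A y (j w) = j z"
  shows "S w \<in> D y" and "S z = A y (S w) + B y (S w)"
  using conjugation_graph[of "S w" "S z" y] assms by blast+

lemma D_in_range_S:
  assumes "v \<in> D y"
  obtains w z where "v = S w" "A y (j w) = j z" "S z = A y v + B y v"
  using conjugation_graph[of v "A y v + B y v" y] assms by metis

text \<open>
  If \<open>S w\<close> lies in \<open>Y\<close>, it lies in the domain of every \<open>A y\<close>, and then the equality of domains in (K2)
  forces \<open>A y\<close> to map \<open>w\<close> into \<open>Y\<close>. This is how the regularity of \<open>S u\<close> is used.
\<close>

lemma A_regular:
  assumes "S w = j v"
  obtains z where "A y (j w) = j z" "S z = A y (j v) + B y (j v)"
proof -
  obtain w' z where "j v = S w'" "A y (j w') = j z" "S z = A y (j v) + B y (j v)"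
    using D_in_range_S[OF j_in_D] .
  then show thesis using assms inj_S that by metis
qed

subsection \<open>Resolvents\<close>

text \<open>
  The number \<open>- 1 / h\<close> lies in the open left half-plane. As it is real, the complexified resolvent
  equation decouples into its real and imaginary parts.
\<close>

lemma resolvent_solvable:
  assumes "0 < h"
  obtains v where "v \<in> D y" "v + h *\<^sub>R A y v = x"
proof -
  let ?l = "complex_of_real (- 1 / h)"
  have "?l \<in> {l. Re l < 0}" using assms by simp
  then have "?l \<in> resolvent_set (D y) (A y)" using K1 unfolding kato_K1_def by blast
  then have "complexified_shift (A y) ?l ` (D y \<times> D y) = UNIV"
    by (auto simp: resolvent_set_def bij_betw_def)
  then have "(- (1 / h) *\<^sub>R x, 0) \<in> complexified_shift (A y) ?l ` (D y \<times> D y)" by blast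
  then obtain v where v: "v \<in> D y" "- (1 / h) *\<^sub>R x = (- 1 / h) *\<^sub>R v - A y v"
    by (auto simp: complexified_shift_def)
  have "h *\<^sub>R (- (1 / h) *\<^sub>R x) = h *\<^sub>R ((- 1 / h) *\<^sub>R v - A y v)" using v(2) by simp
  then have "- x = - v - h *\<^sub>R A y v" using assms by (simp add: scaleR_diff_right)
  then have "v + h *\<^sub>R A y v = x" by (simp add: minus_equation_iff algebra_simps)
  with v(1) show thesis by (rule that)
qed

lemma monotone_norm_le:
  assumes "v \<in> D y" "0 \<le> h"
  shows "norm v \<le> norm (v + h *\<^sub>R A y v)"
proof -
  have "norm v * norm v = inner v v" by (simp add: norm_eq_sqrt_inner)
  also have "\<dots> \<le> inner v (v + h *\<^sub>R A y v)"
    using monotone_A[OF assms(1)] assms(2) by (simp add: inner_add_right)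
  also have "\<dots> \<le> norm v * norm (v + h *\<^sub>R A y v)" by (rule norm_cauchy_schwarz)
  finally show ?thesis by (cases "v = 0") auto
qed

lemma resolvent_contraction:
  assumes "v \<in> D y" "w \<in> D y" "0 \<le> h"
  shows "norm (v - w) \<le> norm ((v + h *\<^sub>R A y v) - (w + h *\<^sub>R A y w))"
  using monotone_norm_le[of "v - w" y h] diff_A[OF assms(1,2)] assms(3)
  by (simp add: algebra_simps)

text \<open>
  Solvability within \<open>Y\<close>. Conjugated by \<open>S\<close>, the equation becomes a resolvent equation in \<open>X\<close> perturbed
  by the bounded operator \<open>h B(y)\<close>, a contraction for small \<open>h\<close>. The solution lies in \<open>D(y)\<close>, hence in the
  range of \<open>S\<close> by the equality of domains, and pulling it back gives an element of \<open>Y\<close>.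
\<close>

lemma resolvent_solvable_Y:
  assumes R: "0 < R" "norm y \<le> R" and h: "0 < h" "h * \<bar>MB R\<bar> < 1"
  obtains m where "j m + h *\<^sub>R A y (j m) = j g"
proof -
  have "\<exists>v. v \<in> D y \<and> v + h *\<^sub>R A y v = x" for x using resolvent_solvable[OF h(1)] by metis
  then obtain J where J: "\<And>x. J x \<in> D y" "\<And>x. J x + h *\<^sub>R A y (J x) = x" by metis
  have "\<exists>!v. J (S g - h *\<^sub>R B y v) = v"
  proof (rule banach_fix_type[of "h * \<bar>MB R\<bar>"])
    show "\<forall>v w. dist (J (S g - h *\<^sub>R B y v)) (J (S g - h *\<^sub>R B y w)) \<le> h * \<bar>MB R\<bar> * dist v w"
    proof (intro allI)
      fix v w
      have "dist (J (S g - h *\<^sub>R B y v)) (J (S g - h *\<^sub>R B y w))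
          \<le> norm ((S g - h *\<^sub>R B y v) - (S g - h *\<^sub>R B y w))"
        using resolvent_contraction[OF J(1) J(1), of h] h(1) by (simp only: J(2) dist_norm less_imp_le)
      also have "\<dots> = h * norm (B y (w - v))"
      proof -
        have "(S g - h *\<^sub>R B y v) - (S g - h *\<^sub>R B y w) = h *\<^sub>R B y (w - v)"
          by (simp add: linear_diff[OF linear_B] scaleR_diff_right)
        then show ?thesis using h(1) by simp
      qed
      also have "\<dots> \<le> h * (\<bar>MB R\<bar> * norm (w - v))"
        using h(1) norm_B_le[OF R] by (intro mult_left_mono) auto
      finally show "dist (J (S g - h *\<^sub>R B y v)) (J (S g - h *\<^sub>R B y w)) \<le> h * \<bar>MB R\<bar> * dist v w"
        by (simp add: dist_norm norm_minus_commute)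
    qed
  qed (use h in auto)
  then obtain v where "J (S g - h *\<^sub>R B y v) = v" by blast
  then have v: "v \<in> D y" "v + h *\<^sub>R A y v = S g - h *\<^sub>R B y v" using J by metis+
  obtain m z where m: "v = S m" "A y (j m) = j z" "S z = A y v + B y v"
    using D_in_range_S[OF v(1)] .
  have "S (m + h *\<^sub>R z) = v + h *\<^sub>R A y v + h *\<^sub>R B y v"
    by (simp add: S.add S.scaleR m scaleR_add_right)
  then have "m + h *\<^sub>R z = g" using v(2) by (simp add: inj_S)
  then have "j m + h *\<^sub>R A y (j m) = j g" by (simp add: m(2) flip: j.add j.scaleR)
  then show thesis by (rule that)
qed

lemma resolvent_bound_Y:
  assumes R: "0 < R" "norm y \<le> R" and h: "0 < h" and m: "j m + h *\<^sub>R A y (j m) = j g"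
  shows "norm m \<le> norm g + h * \<bar>MB R\<bar> * norm m"
proof -
  let ?z = "(1 / h) *\<^sub>R (g - m)"
  have "h *\<^sub>R A y (j m) = j (g - m)" using m by (simp add: j.diff algebra_simps)
  then have "(1 / h) *\<^sub>R (h *\<^sub>R A y (j m)) = (1 / h) *\<^sub>R j (g - m)" by (rule arg_cong)
  then have "A y (j m) = j ?z" using h by (simp add: j.scaleR)
  note z = S_A_eq[OF this]
  have "S m + h *\<^sub>R A y (S m) = S m + h *\<^sub>R S ?z - h *\<^sub>R B y (S m)"
    using z(2) by (simp add: scaleR_add_right)
  also have "\<dots> = S g - h *\<^sub>R B y (S m)"
    using h by (simp add: S.scaleR S.diff)
  finally have "norm (S m) \<le> norm (S g - h *\<^sub>R B y (S m))"
    using monotone_norm_le[OF z(1), of h] h by simp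
  also have "\<dots> \<le> norm (S g) + h * norm (B y (S m))"
    using h norm_triangle_ineq4[of "S g" "h *\<^sub>R B y (S m)"] by simp
  also have "\<dots> \<le> norm (S g) + h * (\<bar>MB R\<bar> * norm (S m))"
    using h norm_B_le[OF R] by (intro add_left_mono mult_left_mono) auto
  finally show ?thesis by (simp add: norm_S)
qed

subsection \<open>Solvability of a midpoint step\<close>

text \<open>
  One step from \<open>y\<close> to \<open>y'\<close> with the coefficients frozen at \<open>c\<close>. Both schemes are instances, so the
  error of a step can be studied for arbitrary \<open>c\<close>.
\<close>

definition midpoint_step :: "real \<Rightarrow> 'y \<Rightarrow> 'y \<Rightarrow> 'y \<Rightarrow> bool" where
  "midpoint_step \<tau> c y y' \<longleftrightarrow>
     (1 / \<tau>) *\<^sub>R j (y' - y) + A c (j ((1/2) *\<^sub>R (y' + y))) = f (j c)"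

text \<open>
  In terms of the average \<open>m\<close> of the old and new values, a step is a resolvent equation with
  parameter \<open>\<tau> / 2\<close>.
\<close>

lemma midpoint_stepI:
  assumes "0 < \<tau>" "j m + (\<tau> / 2) *\<^sub>R A c (j m) = j y + (\<tau> / 2) *\<^sub>R f (j c)"
  shows "midpoint_step \<tau> c y (2 *\<^sub>R m - y)"
proof -
  have "(2 / \<tau>) *\<^sub>R (j m + (\<tau> / 2) *\<^sub>R A c (j m)) = (2 / \<tau>) *\<^sub>R (j y + (\<tau> / 2) *\<^sub>R f (j c))"
    using assms(2) by simp
  then have "(2 / \<tau>) *\<^sub>R j m + A c (j m) = (2 / \<tau>) *\<^sub>R j y + f (j c)"
    using assms(1) by (simp add: scaleR_add_right)
  moreover have "(1 / \<tau>) *\<^sub>R j (2 *\<^sub>R m - y - y) = (2 / \<tau>) *\<^sub>R j m - (2 / \<tau>) *\<^sub>R j y"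
  proof -
    have "2 *\<^sub>R m - y - y = 2 *\<^sub>R (m - y)" by (simp add: scaleR_2 algebra_simps)
    then have "(1 / \<tau>) *\<^sub>R j (2 *\<^sub>R m - y - y) = (1 / \<tau>) *\<^sub>R j (2 *\<^sub>R (m - y))" by (rule arg_cong)
    also have "\<dots> = (2 / \<tau>) *\<^sub>R (j m - j y)" by (simp only: j.scaleR j.diff scaleR_scaleR) simp
    finally show ?thesis by (simp only: scaleR_diff_right)
  qed
  ultimately show ?thesis
    unfolding midpoint_step_def by (simp only: diff_add_cancel) (simp add: algebra_simps)
qed

lemma linear_step_solvable:
  assumes f: "\<And>w. f (j w) \<in> range j" and R: "0 < R"
  obtains \<tau>0 where "0 < \<tau>0"
    and "\<And>\<tau> c y. \<lbrakk>0 < \<tau>; \<tau> \<le> \<tau>0; norm c \<le> R\<rbrakk> \<Longrightarrow> \<exists>y'. midpoint_step \<tau> c y y'"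
proof (rule that[of "1 / (\<bar>MB R\<bar> + 1)"])
  fix \<tau> :: real and c y :: 'y assume \<tau>: "0 < \<tau>" "\<tau> \<le> 1 / (\<bar>MB R\<bar> + 1)" and c: "norm c \<le> R"
  have "\<tau> * (\<bar>MB R\<bar> + 1) \<le> 1" using \<tau>(2) by (simp add: pos_le_divide_eq)
  then have "\<tau> / 2 * \<bar>MB R\<bar> < 1" using \<tau>(1) by (simp add: algebra_simps)
  obtain F where F: "f (j c) = j F" using f by blast
  obtain m where "j m + (\<tau> / 2) *\<^sub>R A c (j m) = j (y + (\<tau> / 2) *\<^sub>R F)"
    using resolvent_solvable_Y[OF R c _ \<open>\<tau> / 2 * \<bar>MB R\<bar> < 1\<close>] \<tau>(1) by (metis half_gt_zero)
  then have "j m + (\<tau> / 2) *\<^sub>R A c (j m) = j y + (\<tau> / 2) *\<^sub>R f (j c)"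
    by (simp add: F j.add j.scaleR)
  then show "\<exists>y'. midpoint_step \<tau> c y y'" using midpoint_stepI[OF \<tau>(1)] by blast
qed simp

text \<open>
  The average \<open>m\<close> solves \<open>m = \<Phi> m\<close>, where \<open>\<Phi> w\<close> solves the resolvent equation with coefficients frozen at
  \<open>w\<close>. On a ball of \<open>Y\<close> this map is a contraction only in the norm of \<open>X\<close>: comparing two values of \<open>\<Phi>\<close> in
  the norm of \<open>Y\<close> would require \<open>S m\<close> to lie in \<open>Y\<close>. Banach's fixed point theorem still applies, because
  the ball is closed in \<open>X\<close>.
\<close>

lemma implicit_step_solvable:
  assumes f: "\<And>w. f (j w) \<in> range j" and R: "0 < R"
  obtains \<tau>0 where "0 < \<tau>0"
    and "\<And>\<tau> y. \<lbrakk>0 < \<tau>; \<tau> \<le> \<tau>0; norm y \<le> R\<rbrakk> \<Longrightarrow>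
           \<exists>y'. norm ((1/2) *\<^sub>R (y' + y)) \<le> R + 1 \<and> midpoint_step \<tau> ((1/2) *\<^sub>R (y' + y)) y y'"
proof -
  define r where "r = R + 1"
  have r: "0 < r" "1 \<le> r" using R by (auto simp: r_def)
  define F where "F w = (SOME z. f (j w) = j z)" for w
  have F: "j (F w) = f (j w)" for w
  proof -
    have "\<exists>z. f (j w) = j z" using f[of w] by blast
    then show ?thesis unfolding F_def by (rule someI_ex[THEN sym])
  qed
  define b where "b = norm (F 0) + \<bar>lY r\<bar> * r"
  have b: "norm (F w) \<le> b" if "norm w \<le> r" for w
  proof -
    have "norm (F w - F 0) \<le> \<bar>lY r\<bar> * norm (w - 0)"
      by (rule f_Lipschitz_Y) (use r that F in auto)
    also have "\<dots> \<le> \<bar>lY r\<bar> * r" using that by (simp add: mult_left_mono)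
    finally show ?thesis unfolding b_def using norm_triangle_sub[of "F w" "F 0"] by linarith
  qed
  have b0: "0 \<le> b" using b[of 0] r norm_ge_zero[of "F 0"] by (simp add: b_def)
  \<comment> \<open>With \<open>h q \<le> 1 / 2\<close>, the first two terms of \<open>q\<close> keep \<open>\<Phi>\<close> inside the ball of radius \<open>r\<close>, and the
    bracket bounds the Lipschitz constant of \<open>\<Phi>\<close> divided by \<open>h\<close>.\<close>
  define q where "q = b + r * \<bar>MB r\<bar> + (\<bar>LA r\<bar> * r + \<bar>lX r\<bar>) + 1"
  have q: "0 < q" "1 \<le> q" using b0 r by (auto simp: q_def add_nonneg_pos)
  show thesis
  proof (rule that[of "1 / q"])
    fix \<tau> :: real and y :: 'y assume \<tau>: "0 < \<tau>" "\<tau> \<le> 1 / q" and y: "norm y \<le> R"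
    define h where "h = \<tau> / 2"
    have h: "0 < h" using \<tau> by (simp add: h_def)
    have "\<tau> * q \<le> 1" using \<tau>(2) q(1) by (simp add: pos_le_divide_eq)
    then have "h * q \<le> 1 / 2" by (simp add: h_def)
    then have hq: "h * b + h * (r * \<bar>MB r\<bar>) + h * (\<bar>LA r\<bar> * r + \<bar>lX r\<bar>) + h \<le> 1 / 2"
      unfolding q_def by (simp add: distrib_left)
    have nn: "0 \<le> h * b" "0 \<le> h * (r * \<bar>MB r\<bar>)" "0 \<le> h * (\<bar>LA r\<bar> * r + \<bar>lX r\<bar>)"
      using h b0 r by auto
    have "h * \<bar>MB r\<bar> \<le> h * (r * \<bar>MB r\<bar>)"
      using h r by (intro mult_left_mono) (auto simp: mult_le_cancel_right1)
    then have hM: "h * \<bar>MB r\<bar> \<le> 1 / 2" using hq nn h by linarith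
    have ex: "\<exists>m. norm m \<le> r \<and> j m + h *\<^sub>R A w (j m) = j y + h *\<^sub>R f (j w)" if w: "norm w \<le> r" for w
    proof -
      have hM1: "h * \<bar>MB r\<bar> < 1" using hM by simp
      obtain m where m: "j m + h *\<^sub>R A w (j m) = j (y + h *\<^sub>R F w)"
        using resolvent_solvable_Y[OF r(1) w h hM1] by blast
      have "norm m \<le> norm (y + h *\<^sub>R F w) + h * \<bar>MB r\<bar> * norm m"
        by (rule resolvent_bound_Y[OF r(1) w h m])
      moreover have "norm (y + h *\<^sub>R F w) \<le> R + h * b"
        using h y b[OF w] by (intro order_trans[OF norm_triangle_ineq] add_mono) auto
      ultimately have "norm m * (1 - h * \<bar>MB r\<bar>) \<le> R + h * b" by (simp add: algebra_simps)
      also have "\<dots> \<le> r * (1 - h * \<bar>MB r\<bar>)"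
        using hq nn h unfolding r_def by (simp add: algebra_simps)
      finally have "norm m \<le> r" using hM1 by simp
      then show ?thesis using m by (auto simp: j.add j.scaleR F)
    qed
    then obtain \<Phi> where \<Phi>: "\<And>w. norm w \<le> r \<Longrightarrow> norm (\<Phi> w) \<le> r"
      "\<And>w. norm w \<le> r \<Longrightarrow> j (\<Phi> w) + h *\<^sub>R A w (j (\<Phi> w)) = j y + h *\<^sub>R f (j w)"
      by metis
    have lip: "norm (j (\<Phi> w) - j (\<Phi> w')) \<le> 1 / 2 * norm (j w - j w')"
      if w: "norm w \<le> r" "norm w' \<le> r" for w w'
    proof -
      let ?m = "\<Phi> w" and ?m' = "\<Phi> w'"
      have "norm (j ?m - j ?m') \<le> norm ((j ?m + h *\<^sub>R A w (j ?m)) - (j ?m' + h *\<^sub>R A w (j ?m')))"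
        using h by (intro resolvent_contraction j_in_D) auto
      also have "(j ?m + h *\<^sub>R A w (j ?m)) - (j ?m' + h *\<^sub>R A w (j ?m'))
          = h *\<^sub>R (f (j w) - f (j w')) - h *\<^sub>R (A w (j ?m') - A w' (j ?m'))"
      proof -
        have "j ?m' = j y + h *\<^sub>R f (j w') - h *\<^sub>R A w' (j ?m')" using \<Phi>(2)[OF w(2)] by (simp add: algebra_simps)
        then have "(j ?m + h *\<^sub>R A w (j ?m)) - (j ?m' + h *\<^sub>R A w (j ?m'))
          = (j y + h *\<^sub>R f (j w)) - (j y + h *\<^sub>R f (j w') - h *\<^sub>R A w' (j ?m') + h *\<^sub>R A w (j ?m'))"
          using \<Phi>(2)[OF w(1)] by metis
        then show ?thesis by (simp add: scaleR_diff_right)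
      qed
      also have "norm \<dots> \<le> h * norm (f (j w) - f (j w')) + h * norm (A w (j ?m') - A w' (j ?m'))"
        using h by (intro order_trans[OF norm_triangle_ineq4]) simp
      also have "\<dots> \<le> h * (\<bar>lX r\<bar> * norm (j w - j w')) + h * (\<bar>LA r\<bar> * norm (j w - j w') * r)"
      proof (intro add_mono mult_left_mono)
        show "norm (f (j w) - f (j w')) \<le> \<bar>lX r\<bar> * norm (j w - j w')"
          by (rule f_Lipschitz_X[OF r(1) w])
        have "norm (A w (j ?m') - A w' (j ?m')) \<le> \<bar>LA r\<bar> * norm (j w - j w') * norm ?m'"
          by (rule A_Lipschitz[OF r(1) w])
        also have "\<dots> \<le> \<bar>LA r\<bar> * norm (j w - j w') * r"
          using \<Phi>(1)[OF w(2)] by (intro mult_left_mono) auto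
        finally show "norm (A w (j ?m') - A w' (j ?m')) \<le> \<bar>LA r\<bar> * norm (j w - j w') * r" .
      qed (use h in auto)
      also have "\<dots> = (h * (\<bar>LA r\<bar> * r + \<bar>lX r\<bar>)) * norm (j w - j w')" by (simp add: algebra_simps)
      also have "\<dots> \<le> 1 / 2 * norm (j w - j w')"
        using hq nn h by (intro mult_right_mono) auto
      finally show ?thesis .
    qed
    let ?Z = "j ` cball 0 r"
    let ?\<psi> = "\<lambda>x. j (\<Phi> (the_inv j x))"
    have inj: "inj j" using inj_j by (auto simp: inj_def)
    have "\<exists>!x\<in>?Z. ?\<psi> x = x"
    proof (rule Banach_fix)
      show "complete ?Z" using closed_image_cball[OF bounded_linear_j] complete_eq_closed by blast
      show "?\<psi> ` ?Z \<subseteq> ?Z" using \<Phi>(1) by (auto simp: the_inv_f_f[OF inj])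
      show "dist (?\<psi> x) (?\<psi> x') \<le> 1 / 2 * dist x x'" if "x \<in> ?Z" "x' \<in> ?Z" for x x'
        using that lip by (auto simp: the_inv_f_f[OF inj] dist_norm)
    qed (use r in auto)
    then obtain m where m: "norm m \<le> r" "\<Phi> m = m"
      by (auto simp: the_inv_f_f[OF inj] inj_j)
    have "midpoint_step \<tau> m y (2 *\<^sub>R m - y)"
      using \<Phi>(2)[OF m(1)] by (intro midpoint_stepI[OF \<tau>(1)]) (simp add: m(2) h_def)
    moreover have "(1/2) *\<^sub>R ((2 *\<^sub>R m - y) + y) = m" by simp
    ultimately show "\<exists>y'. norm ((1/2) *\<^sub>R (y' + y)) \<le> R + 1 \<and> midpoint_step \<tau> ((1/2) *\<^sub>R (y' + y)) y y'"
      using m(1) by (metis r_def)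
  qed (use q in auto)
qed

end

section \<open>A discrete Gronwall inequality\<close>

text \<open>
  A majorant of the error after \<open>n\<close> steps. Up to the exponential factor, \<open>2 K \<tau>\<^sup>2\<close> accounts for the first
  step, in which the extrapolated argument is only first-order accurate, and \<open>2 K \<tau>\<^sup>2 n \<tau>\<close> for
  the accumulated defects of size \<open>\<tau>\<^sup>3\<close> of the other steps.
\<close>

definition error_growth :: "real \<Rightarrow> real \<Rightarrow> nat \<Rightarrow> real" where
  "error_growth K \<tau> n = (1 + 6 * \<tau> * K) ^ n * (2 * K * \<tau>\<^sup>2 * (1 + real n * \<tau>))"

lemma error_growth_nonneg: "0 \<le> K \<Longrightarrow> 0 < \<tau> \<Longrightarrow> 0 \<le> error_growth K \<tau> n"
  by (simp add: error_growth_def)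

lemma error_growth_le:
  assumes "0 \<le> K" "0 < \<tau>" "real n * \<tau> \<le> T"
  shows "error_growth K \<tau> n \<le> exp (6 * K * T) * (2 * K * (1 + T)) * \<tau>\<^sup>2"
proof -
  have "(1 + 6 * \<tau> * K) ^ n \<le> exp (6 * \<tau> * K) ^ n"
    using assms by (intro power_mono exp_ge_add_one_self) auto
  also have "\<dots> = exp (6 * K * (real n * \<tau>))" by (simp flip: exp_of_nat_mult add: mult_ac)
  also have "\<dots> \<le> exp (6 * K * T)" using assms by (simp add: mult_left_mono)
  finally have "error_growth K \<tau> n \<le> exp (6 * K * T) * (2 * K * \<tau>\<^sup>2 * (1 + T))"
    unfolding error_growth_def using assms by (intro mult_mono) auto
  also have "\<dots> = exp (6 * K * T) * (2 * K * (1 + T)) * \<tau>\<^sup>2" by simp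
  finally show ?thesis .
qed

lemma error_growth_Suc_ge:
  assumes "0 \<le> K" "0 < \<tau>"
  shows "(1 + 6 * \<tau> * K) * error_growth K \<tau> n + 2 * K * \<tau>\<^sup>2 * \<tau> \<le> error_growth K \<tau> (Suc n)"
proof -
  have "1 \<le> (1 + 6 * \<tau> * K) ^ Suc n" using assms by (intro one_le_power) simp
  then have "1 * (2 * K * \<tau>\<^sup>2 * \<tau>) \<le> (1 + 6 * \<tau> * K) ^ Suc n * (2 * K * \<tau>\<^sup>2 * \<tau>)"
    using assms by (intro mult_right_mono) auto
  moreover have "error_growth K \<tau> (Suc n)
      = (1 + 6 * \<tau> * K) * error_growth K \<tau> n + (1 + 6 * \<tau> * K) ^ Suc n * (2 * K * \<tau>\<^sup>2 * \<tau>)"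
    by (simp add: error_growth_def algebra_simps)
  ultimately show ?thesis by simp
qed

lemma error_growth_mono:
  assumes "0 \<le> K" "0 < \<tau>"
  shows "error_growth K \<tau> n \<le> error_growth K \<tau> (Suc n)"
proof -
  have "0 \<le> 6 * \<tau> * K * error_growth K \<tau> n + 2 * K * \<tau>\<^sup>2 * \<tau>"
    using assms error_growth_nonneg[OF assms] by simp
  then show ?thesis using error_growth_Suc_ge[OF assms, of n] by (simp add: algebra_simps)
qed

text \<open>
  In the recursion \<open>a\<close>, \<open>b\<close>, \<open>c\<close> are three consecutive errors, or \<open>a = 0\<close> for a one-step scheme. The defect \<open>\<delta>\<close> may be as large as \<open>\<tau>\<close> in the
  first step, since it enters multiplied by \<open>\<tau>\<close> and the initial error is zero.
\<close>

lemma discrete_gronwall_step: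
  assumes K: "0 \<le> K" and \<tau>: "0 < \<tau>" "\<tau> * K \<le> 1 / 2"
    and a: "a \<le> error_growth K \<tau> n" and b: "b \<le> error_growth K \<tau> n"
    and start: "n = 0 \<Longrightarrow> a = 0 \<and> b = 0"
    and \<delta>: "\<delta> \<le> (if n = 0 then \<tau> else \<tau>\<^sup>2)"
    and c: "c \<le> b + \<tau> * K * (c + b + a + \<delta>)"
  shows "c \<le> error_growth K \<tau> (Suc n)"
proof -
  define x where "x = \<tau> * K"
  have x: "0 \<le> x" "x \<le> 1 / 2" using K \<tau> by (auto simp: x_def)
  define g where "g = error_growth K \<tau> n"
  have g0: "0 \<le> g" unfolding g_def using K \<tau>(1) by (rule error_growth_nonneg)
  have up: "(1 + 6 * x) * g + 2 * K * \<tau>\<^sup>2 * \<tau> \<le> error_growth K \<tau> (Suc n)"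
    using error_growth_Suc_ge[OF K \<tau>(1), of n] by (simp add: x_def g_def mult_ac)
  \<comment> \<open>Absorbing \<open>x * c\<close> into the left-hand side costs the factor \<open>1 / (1 - x) \<le> 2\<close>, and
    \<open>(1 + 2 * x) / (1 - x) \<le> 1 + 6 * x\<close> for \<open>x \<le> 1 / 2\<close>.\<close>
  show ?thesis
  proof (cases "n = 0")
    case True
    then have "c \<le> x * c + x * \<delta>" using c start by (simp add: x_def algebra_simps)
    moreover have "x * \<delta> \<le> x * \<tau>" using \<delta> True x(1) by (intro mult_left_mono) auto
    ultimately have "(1 - x) * c \<le> x * \<tau>" by (simp add: algebra_simps)
    also have "\<dots> \<le> (1 - x) * (2 * (x * \<tau>))"
    proof -
      have "1 * (x * \<tau>) \<le> ((1 - x) * 2) * (x * \<tau>)" using x \<tau>(1) by (intro mult_right_mono) auto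
      then show ?thesis by (simp only: mult_1 mult.assoc)
    qed
    finally have "c \<le> 2 * (x * \<tau>)" using x by simp
    also have "\<dots> = 2 * K * \<tau>\<^sup>2" by (simp add: x_def power2_eq_square)
    also have "\<dots> = g" using True by (simp add: g_def error_growth_def)
    also have "\<dots> \<le> error_growth K \<tau> (Suc n)" unfolding g_def by (rule error_growth_mono[OF K \<tau>(1)])
    finally show ?thesis .
  next
    case False
    have "c \<le> b + x * c + x * b + x * a + x * \<delta>" using c by (simp add: x_def algebra_simps)
    moreover have "x * b \<le> x * g" "x * a \<le> x * g" "b \<le> g" "x * \<delta> \<le> x * \<tau>\<^sup>2"
      using a b \<delta> False x(1) by (auto simp: g_def intro!: mult_left_mono)
    ultimately have "(1 - x) * c \<le> (1 + 2 * x) * g + x * \<tau>\<^sup>2" by (simp add: algebra_simps)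
    also have "\<dots> \<le> ((1 - x) * (1 + 6 * x)) * g + ((1 - x) * 2) * (x * \<tau>\<^sup>2)"
    proof (intro add_mono mult_right_mono)
      have "x * x \<le> x * (1 / 2)" using x by (intro mult_left_mono) auto
      then show "1 + 2 * x \<le> (1 - x) * (1 + 6 * x)" by (simp add: algebra_simps)
      have "1 * (x * \<tau>\<^sup>2) \<le> ((1 - x) * 2) * (x * \<tau>\<^sup>2)" using x by (intro mult_right_mono) auto
      then show "x * \<tau>\<^sup>2 \<le> ((1 - x) * 2) * (x * \<tau>\<^sup>2)" by simp
    qed (use g0 in auto)
    also have "\<dots> = (1 - x) * ((1 + 6 * x) * g + 2 * (x * \<tau>\<^sup>2))" by (simp add: algebra_simps)
    finally have "c \<le> (1 + 6 * x) * g + 2 * (x * \<tau>\<^sup>2)" using x by simp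
    also have "2 * (x * \<tau>\<^sup>2) = 2 * K * \<tau>\<^sup>2 * \<tau>" by (simp add: x_def)
    finally show ?thesis using up by simp
  qed
qed

section \<open>Stability and consistency of one step\<close>

context kato_operators
begin

text \<open>
  Testing the equation with the average of \<open>E\<close> and \<open>E'\<close> turns the difference quotient into
  \<open>(\<bar>E'\<bar>\<^sup>2 - \<bar>E\<bar>\<^sup>2) / (2 \<tau>)\<close>, and the monotone operator only helps. The difference of squares contains the
  factor \<open>\<bar>E'\<bar> + \<bar>E\<bar>\<close>, which cancels against the bound of the test function on the right.
\<close>

lemma energy_estimate:
  assumes R: "0 < R" "norm c \<le> R" and \<tau>: "0 < \<tau>"
    and dom: "(1/2) *\<^sub>R (E' + E) \<in> D c"
    and eq: "(1 / \<tau>) *\<^sub>R (E' - E) + A c ((1/2) *\<^sub>R (E' + E)) + B c ((1/2) *\<^sub>R (E' + E)) = r"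
  shows "norm E' \<le> norm E + \<tau> * (\<bar>MB R\<bar> * (norm E' + norm E) + norm r)"
proof -
  define W where "W = (1/2) *\<^sub>R (E' + E)"
  define s where "s = (norm E' + norm E) / 2"
  have s: "norm W \<le> s" "0 \<le> s"
    using norm_triangle_ineq[of E' E] by (auto simp: W_def s_def)
  have "(norm E' - norm E) * s = ((norm E')\<^sup>2 - (norm E)\<^sup>2) / 2"
    by (simp add: s_def power2_eq_square algebra_simps)
  also have "\<dots> = inner W (E' - E)"
    by (simp add: W_def power2_norm_eq_inner algebra_simps diff_divide_distrib inner_commute)
  also have "\<dots> = \<tau> * inner W ((1 / \<tau>) *\<^sub>R (E' - E))" using \<tau> by simp
  also have "\<dots> \<le> \<tau> * (norm W * norm r + norm W * norm (B c W))"
  proof (rule mult_left_mono)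
    have "(1 / \<tau>) *\<^sub>R (E' - E) = r - A c W - B c W" using eq by (auto simp: W_def algebra_simps)
    then have "inner W ((1 / \<tau>) *\<^sub>R (E' - E)) = inner W r - inner W (A c W) - inner W (B c W)"
      by (simp only: inner_diff_right)
    moreover have "0 \<le> inner W (A c W)" using monotone_A[OF dom] by (simp only: W_def)
    moreover have "- inner W (B c W) \<le> norm W * norm (B c W)"
      using norm_cauchy_schwarz[of W "- B c W"] by simp
    ultimately show "inner W ((1 / \<tau>) *\<^sub>R (E' - E)) \<le> norm W * norm r + norm W * norm (B c W)"
      using norm_cauchy_schwarz[of W r] by linarith
  qed (use \<tau> in simp)
  finally have "(norm E' - norm E) * s \<le> \<tau> * (norm W * norm r + norm W * norm (B c W))" .
  also have "\<dots> \<le> \<tau> * (s * norm r + s * (\<bar>MB R\<bar> * s))"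
    using \<tau> s norm_B_le[OF R, of W]
    by (intro mult_left_mono add_mono mult_mono mult_right_mono
        order_trans[OF norm_B_le[OF R]]) auto
  finally have bound: "(norm E' - norm E) * s \<le> (\<tau> * (norm r + \<bar>MB R\<bar> * s)) * s"
    by (simp add: algebra_simps)
  show ?thesis
  proof (cases "s = 0")
    case True
    then have "E' = 0" by (simp add: s_def add_nonneg_eq_0_iff)
    then show ?thesis using \<tau> by simp
  next
    case False
    then have "norm E' - norm E \<le> \<tau> * (norm r + \<bar>MB R\<bar> * s)"
      using bound s(2) by (simp add: mult_le_cancel_right)
    also have "\<dots> \<le> \<tau> * (\<bar>MB R\<bar> * (norm E' + norm E) + norm r)"
    proof -
      have "\<bar>MB R\<bar> * s \<le> \<bar>MB R\<bar> * (norm E' + norm E)" by (intro mult_left_mono) (auto simp: s_def)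
      then show ?thesis using \<tau> by (intro mult_left_mono) auto
    qed
    finally show ?thesis by linarith
  qed
qed

end

locale kato_evolution = kato_operators j D A B S f MA MB LA LB lX lY
  for j :: "'y::{real_inner,complete_space} \<Rightarrow> 'x::{real_inner,complete_space}"
    and D A B S f MA MB LA LB lX lY +
  fixes T :: real and u v :: "real \<Rightarrow> 'y"
  assumes T_pos: "0 < T"
    and solution: "evolution_solution j A f T u"
    and u_smooth: "Ck_on 3 {0..T} u"
    and S_u: "\<forall>t\<in>{0..T}. S (u t) = j (v t)"
    and v_smooth: "Ck_on 2 {0..T} v"
begin

text \<open>
  The derivative of the solution in \<open>X\<close> is the image of its derivative in \<open>Y\<close>.
\<close>

lemma exact_equation:
  assumes t: "t \<in> {0..T}" and d: "(u has_vector_derivative d) (at t within {0..T})"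
  shows "j d + A (u t) (j (u t)) = f (j (u t))"
proof -
  obtain d' where d': "((\<lambda>s. j (u s)) has_vector_derivative d') (at t within {0..T})"
      "d' + A (u t) (j (u t)) = f (j (u t))"
    using solution t unfolding evolution_solution_def by blast
  have "((\<lambda>s. j (u s)) has_vector_derivative j d) (at t within {0..T})"
    using bounded_linear.has_vector_derivative[OF bounded_linear_j d] .
  then have "j d = d'"
    using vector_derivative_unique_within_closed_interval[of 0 T t] T_pos t d'(1) by auto
  then show ?thesis using d'(2) by simp
qed

text \<open>
  (K4) only controls differences of values of \<open>f\<close>. That one value belongs to \<open>Y\<close> can be read off from the
  exact equation at time zero, whose other terms lie in \<open>Y\<close> by the assumed regularity.
\<close>

lemma f_in_Y: "f (j w) \<in> range j"
proof -
  have 0: "0 \<in> {0..T}" using T_pos by simp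
  obtain d where "(u has_vector_derivative d) (at 0 within {0..T})"
    using difference_quotient_at_midpoint[OF u_smooth] 0 by metis
  then have "j d + A (u 0) (j (u 0)) = f (j (u 0))" by (rule exact_equation[OF 0])
  moreover obtain z where "A (u 0) (j (u 0)) = j z" using A_regular S_u 0 by metis
  ultimately have "j (d + z) = f (j (u 0))" by (simp add: j.add)
  moreover obtain e where "j e = f (j w) - f (j (u 0))" using f_diff_in_Y by blast
  ultimately have "f (j w) = j (e + (d + z))" by (simp add: j.add)
  then show ?thesis by blast
qed

text \<open>
  The error equation, conjugated by \<open>S\<close>. The numerical step is compared with the exact equation at the
  midpoint \<open>h = t + \<tau> / 2\<close> of the time interval. Only the exact solution is inserted into differences
  of operators, and there \<open>S u\<close> lies in \<open>Y\<close>, so that (K3) bounds the conjugated difference by the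
  error of the frozen argument \<open>c\<close> in the norm of \<open>Y\<close>.
\<close>

lemma one_step_error:
  assumes R: "0 < R" "\<And>t. t \<in> {0..T} \<Longrightarrow> norm (u t) \<le> R"
  obtains K where "0 \<le> K"
    and "\<And>\<tau> t c y y'. \<lbrakk>0 < \<tau>; 0 \<le> t; t + \<tau> \<le> T; norm c \<le> R; midpoint_step \<tau> c y y'\<rbrakk> \<Longrightarrow>
           norm (y' - u (t + \<tau>)) \<le> norm (y - u t) + \<tau> * K *
             (norm (y' - u (t + \<tau>)) + norm (y - u t) + (norm (c - u (t + \<tau> / 2)) + \<tau>\<^sup>2))"
proof -
  obtain u1 C1 where u1: "0 \<le> C1"
      "\<And>t. t \<in> {0..T} \<Longrightarrow> (u has_vector_derivative u1 t) (at t within {0..T})"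
      "\<And>t \<tau>. \<lbrakk>0 \<le> t; 0 < \<tau>; t + \<tau> \<le> T\<rbrakk> \<Longrightarrow>
           norm (u1 (t + \<tau> / 2) - (1 / \<tau>) *\<^sub>R (u (t + \<tau>) - u t)) \<le> C1 * \<tau>\<^sup>2"
    by (rule difference_quotient_at_midpoint[OF u_smooth]) (rule that)
  obtain C2 where C2: "0 \<le> C2"
      "\<And>t \<tau>. \<lbrakk>0 \<le> t; 0 < \<tau>; t + \<tau> \<le> T\<rbrakk> \<Longrightarrow>
           norm ((1/2) *\<^sub>R (v (t + \<tau>) + v t) - v (t + \<tau> / 2)) \<le> C2 * \<tau>\<^sup>2"
    by (rule average_at_midpoint[OF v_smooth]) (rule that)
  obtain V where V: "0 \<le> V" "\<And>t. t \<in> {0..T} \<Longrightarrow> norm (v t) \<le> V"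
    by (rule continuous_on_norm_bound[OF Ck_on_imp_continuous_on[OF v_smooth]]) (rule that)
  define K where "K = \<bar>MB R\<bar> + \<bar>lY R\<bar> + \<bar>LA R\<bar> * V + \<bar>LB R\<bar> * V + (C1 + \<bar>MA R\<bar> * C2 + \<bar>MB R\<bar> * C2)"
  show thesis
  proof (rule that[of K])
    show "0 \<le> K" unfolding K_def using u1(1) C2(1) V(1) by simp
    fix \<tau> t c y y'
    assume \<tau>: "0 < \<tau>" and t: "0 \<le> t" "t + \<tau> \<le> T" and c: "norm c \<le> R"
      and step: "midpoint_step \<tau> c y y'"
    define h where "h = t + \<tau> / 2"
    define m where "m = (1/2) *\<^sub>R (y' + y)"
    define us where "us = (1/2) *\<^sub>R (u (t + \<tau>) + u t)"
    define vs where "vs = (1/2) *\<^sub>R (v (t + \<tau>) + v t)"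
    have mem: "t \<in> {0..T}" "t + \<tau> \<in> {0..T}" "h \<in> {0..T}" using t \<tau> by (auto simp: h_def)
    have S_us: "S us = j vs"
      using S_u mem by (simp add: us_def vs_def S.scaleR S.add j.scaleR j.add)
    have S_uh: "S (u h) = j (v h)" using S_u mem by simp
    obtain F where F: "j F = f (j c)" using f_in_Y by (metis rangeE)
    obtain Fh where Fh: "j Fh = f (j (u h))" using f_in_Y by (metis rangeE)
    have "A c (j m) = j (F - (1 / \<tau>) *\<^sub>R (y' - y))"
      using step by (simp add: midpoint_step_def m_def F j.add j.diff j.scaleR algebra_simps)
    note num = S_A_eq[OF this]
    have "A (u h) (j (u h)) = j (Fh - u1 h)"
      using exact_equation[OF mem(3) u1(2)[OF mem(3)]] by (simp add: Fh j.diff algebra_simps)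
    note ex = S_A_eq(2)[OF this]
    define E' where "E' = S (y' - u (t + \<tau>))"
    define E where "E = S (y - u t)"
    have W: "(1/2) *\<^sub>R (E' + E) = S m - j vs"
      unfolding E_def E'_def m_def S_us[symmetric] us_def
      by (simp add: S.diff S.add S.scaleR algebra_simps)
    \<comment> \<open>The residual consists of the perturbations of \<open>f\<close>, \<open>A\<close> and \<open>B\<close> at the exact solution and of the
      defects of the difference quotient of \<open>u\<close> and the average of \<open>v\<close>.\<close>
    define r where "r = S (F - Fh) + S (u1 h - (1 / \<tau>) *\<^sub>R (u (t + \<tau>) - u t))
        + (A (u h) (j (v h)) - A c (j (v h))) + A c (j (v h - vs))
        + (B (u h) (j (v h)) - B c (j (v h))) + B c (j (v h - vs))"
    have dom: "(1/2) *\<^sub>R (E' + E) \<in> D c"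
      unfolding W using diff_A[OF num(1) j_in_D] by blast
    have AW: "A c (S m - j vs) = A c (S m) - A c (j vs)" using diff_A[OF num(1) j_in_D] by blast
    have BW: "B c (S m - j vs) = B c (S m) - B c (j vs)" by (rule linear_diff[OF linear_B])
    have Ad: "A c (j (v h - vs)) = A c (j (v h)) - A c (j vs)"
      using diff_A[OF j_in_D j_in_D] by (simp add: j.diff)
    have Bd: "B c (j (v h - vs)) = B c (j (v h)) - B c (j vs)"
      by (simp add: j.diff linear_diff[OF linear_B])
    have "S Fh - S (u1 h) = A (u h) (j (v h)) + B (u h) (j (v h))"
      using ex by (simp add: S_uh S.diff)
    then have "r = S F - (1 / \<tau>) *\<^sub>R (S (u (t + \<tau>)) - S (u t)) - A c (j vs) - B c (j vs)"
      unfolding r_def Ad Bd by (simp add: S.add S.diff S.scaleR algebra_simps)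
    moreover have "S F = A c (S m) + B c (S m) + (1 / \<tau>) *\<^sub>R (S y' - S y)"
      using num(2) by (simp add: S.add S.diff S.scaleR algebra_simps)
    ultimately have r_eq: "r = A c (S m) + B c (S m) + (1 / \<tau>) *\<^sub>R (S y' - S y)
        - (1 / \<tau>) *\<^sub>R (S (u (t + \<tau>)) - S (u t)) - A c (j vs) - B c (j vs)" by simp
    have "(1 / \<tau>) *\<^sub>R (E' - E) + A c (S m - j vs) + B c (S m - j vs) = r"
      unfolding AW BW E_def E'_def r_eq by (simp add: S.diff algebra_simps)
    then have energy: "norm E' \<le> norm E + \<tau> * (\<bar>MB R\<bar> * (norm E' + norm E) + norm r)"
      using energy_estimate[OF R(1) c \<tau> dom] W by simp
    define \<eta> where "\<eta> = norm (c - u h)"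
    have uh: "norm (u h) \<le> R" using R(2) mem by blast
    have vh: "norm (v h) \<le> V" using V(2) mem by blast
    have \<eta>: "0 \<le> \<eta>" "norm (u h - c) = \<eta>" by (auto simp: \<eta>_def norm_minus_commute)
    have j\<eta>: "norm (j (u h) - j c) \<le> \<eta>" using norm_j_le[of "u h - c"] \<eta> by (simp add: j.diff)
    have vd: "norm (v h - vs) \<le> C2 * \<tau>\<^sup>2"
      using C2(2)[OF t(1) \<tau> t(2)] by (simp add: h_def vs_def norm_minus_commute)
    have "norm r \<le> norm (S (F - Fh)) + norm (S (u1 h - (1 / \<tau>) *\<^sub>R (u (t + \<tau>) - u t)))
        + norm (A (u h) (j (v h)) - A c (j (v h))) + norm (A c (j (v h - vs)))
        + norm (B (u h) (j (v h)) - B c (j (v h))) + norm (B c (j (v h - vs)))"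
      unfolding r_def by (intro norm_triangle_le add_mono order_refl)
    also have "\<dots> \<le> \<bar>lY R\<bar> * \<eta> + C1 * \<tau>\<^sup>2 + \<bar>LA R\<bar> * \<eta> * V + \<bar>MA R\<bar> * (C2 * \<tau>\<^sup>2)
        + \<bar>LB R\<bar> * \<eta> * V + \<bar>MB R\<bar> * (C2 * \<tau>\<^sup>2)"
    proof (intro add_mono)
      show "norm (S (F - Fh)) \<le> \<bar>lY R\<bar> * \<eta>"
        unfolding norm_S \<eta>_def by (rule f_Lipschitz_Y[OF R(1) c uh F Fh])
      show "norm (S (u1 h - (1 / \<tau>) *\<^sub>R (u (t + \<tau>) - u t))) \<le> C1 * \<tau>\<^sup>2"
        using u1(3)[OF t(1) \<tau> t(2)] by (simp add: norm_S h_def)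
      show "norm (A (u h) (j (v h)) - A c (j (v h))) \<le> \<bar>LA R\<bar> * \<eta> * V"
        using j\<eta> vh \<eta> by (intro order_trans[OF A_Lipschitz[OF R(1) uh c]] mult_mono) auto
      show "norm (A c (j (v h - vs))) \<le> \<bar>MA R\<bar> * (C2 * \<tau>\<^sup>2)"
        using vd by (intro order_trans[OF norm_A_le[OF R(1) c]] mult_left_mono) auto
      show "norm (B (u h) (j (v h)) - B c (j (v h))) \<le> \<bar>LB R\<bar> * \<eta> * V"
        using vh \<eta> norm_j_le[of "v h"] by (intro order_trans[OF B_Lipschitz[OF R(1) uh c]] mult_mono) auto
      show "norm (B c (j (v h - vs))) \<le> \<bar>MB R\<bar> * (C2 * \<tau>\<^sup>2)"
        using vd norm_j_le[of "v h - vs"] by (intro order_trans[OF norm_B_le[OF R(1) c]] mult_left_mono) auto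
    qed
    finally have r: "norm r \<le> (\<bar>lY R\<bar> + \<bar>LA R\<bar> * V + \<bar>LB R\<bar> * V) * \<eta> + (C1 + \<bar>MA R\<bar> * C2 + \<bar>MB R\<bar> * C2) * \<tau>\<^sup>2"
      by (simp add: algebra_simps)
    also have "\<dots> \<le> (K - \<bar>MB R\<bar>) * \<eta> + (K - \<bar>MB R\<bar>) * \<tau>\<^sup>2"
      unfolding K_def using \<eta>(1) u1(1) C2(1) V(1) by (intro add_mono mult_right_mono) auto
    finally have "\<bar>MB R\<bar> * (norm E' + norm E) + norm r
        \<le> \<bar>MB R\<bar> * (norm E' + norm E) + (K - \<bar>MB R\<bar>) * (\<eta> + \<tau>\<^sup>2)"
      by (simp add: algebra_simps)
    also have "\<dots> \<le> K * (norm E' + norm E) + K * (\<eta> + \<tau>\<^sup>2)"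
      unfolding K_def using \<eta>(1) u1(1) C2(1) V(1) by (intro add_mono mult_right_mono) auto
    finally have "\<bar>MB R\<bar> * (norm E' + norm E) + norm r \<le> K * (norm E' + norm E + (\<eta> + \<tau>\<^sup>2))"
      by (simp add: algebra_simps)
    then have "norm E' \<le> norm E + \<tau> * (K * (norm E' + norm E + (\<eta> + \<tau>\<^sup>2)))"
      using energy \<tau> by (meson add_left_mono less_imp_le mult_left_mono order_trans)
    then show "norm (y' - u (t + \<tau>)) \<le> norm (y - u t) + \<tau> * K *
             (norm (y' - u (t + \<tau>)) + norm (y - u t) + (norm (c - u (t + \<tau> / 2)) + \<tau>\<^sup>2))"
      by (simp add: E_def E'_def norm_S \<eta>_def h_def mult.assoc)
  qed
qed

section \<open>Convergence of the two schemes\<close>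

lemma midpoint_solution_iff:
  "midpoint_solution j A f mid T \<tau> y0 us \<longleftrightarrow>
     us 0 = y0 \<and> (\<forall>n. real (Suc n) * \<tau> \<le> T \<longrightarrow> midpoint_step \<tau> (mid us n) (us n) (us (Suc n)))"
  by (simp add: midpoint_solution_def midpoint_step_def)

lemma continuous_u: "continuous_on {0..T} u"
  using u_smooth by (rule Ck_on_imp_continuous_on)

lemma u_C2: "Ck_on 2 {0..T} u"
proof -
  have weaken: "Ck_on (Suc k) I g \<Longrightarrow> Ck_on k I g" for k I and g :: "real \<Rightarrow> 'y"
  proof (induction k arbitrary: g)
    case 0
    then show ?case using Ck_on_imp_continuous_on by (metis Ck_on.simps(1))
  next
    case (Suc k)
    then show ?case unfolding Ck_on.simps(2)[of _ I g] by blast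
  qed
  show ?thesis by (rule weaken) (use u_smooth in \<open>simp only: eval_nat_numeral\<close>)
qed

lemma grid_successor: "real (Suc n) * \<tau> = real n * \<tau> + \<tau>"
  by (simp add: algebra_simps)

text \<open>
  The error bound and the existence of a solution support each other: a small error keeps the numerical
  solution inside the ball of radius \<open>R\<close>, which is what solving the next step requires. The
  averages are only known to stay in the ball of radius \<open>R + 1\<close>, so the constants are taken there.
\<close>

lemma implicit_midpoint_convergence:
  assumes R: "\<And>t. t \<in> {0..T} \<Longrightarrow> norm (u t) < R"
  shows "\<exists>\<tau>bar>0. \<exists>C. \<forall>\<tau>. 0 < \<tau> \<and> \<tau> \<le> \<tau>bar \<longrightarrow>
     (\<exists>us. midpoint_solution j A f implicit_mid T \<tau> (u 0) us \<and> bounded_on_grid R T \<tau> us) \<and>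
     (\<forall>us. midpoint_solution j A f implicit_mid T \<tau> (u 0) us \<and> bounded_on_grid R T \<tau> us \<longrightarrow>
        (\<forall>n. real n * \<tau> \<le> T \<longrightarrow> norm (us n - u (real n * \<tau>)) \<le> C * \<tau>\<^sup>2))"
proof -
  have "0 \<in> {0..T}" using T_pos by simp
  from R[OF this] have R0: "0 < R" using norm_ge_zero[of "u 0"] by linarith
  have "\<exists>s\<in>{0..T}. \<forall>t\<in>{0..T}. norm (u t) \<le> norm (u s)"
    using T_pos by (intro continuous_attains_sup continuous_on_norm continuous_u) auto
  then obtain s where s: "s \<in> {0..T}" "\<And>t. t \<in> {0..T} \<Longrightarrow> norm (u t) \<le> norm (u s)" by blast
  define gap where "gap = R - norm (u s)"
  have gap: "0 < gap" "\<And>t. t \<in> {0..T} \<Longrightarrow> norm (u t) + gap \<le> R"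
    using R s by (auto simp: gap_def)
  have R1: "0 < R + 1" using R0 by simp
  have R2: "norm (u t) \<le> R + 1" if "t \<in> {0..T}" for t using R[OF that] by simp
  obtain K0 where K0: "0 \<le> K0"
    "\<And>\<tau> t c y y'. \<lbrakk>0 < \<tau>; 0 \<le> t; t + \<tau> \<le> T; norm c \<le> R + 1; midpoint_step \<tau> c y y'\<rbrakk> \<Longrightarrow>
       norm (y' - u (t + \<tau>)) \<le> norm (y - u t) + \<tau> * K0 *
         (norm (y' - u (t + \<tau>)) + norm (y - u t) + (norm (c - u (t + \<tau> / 2)) + \<tau>\<^sup>2))"
    by (rule one_step_error[OF R1 R2]) (assumption, rule that)
  obtain C1 where C1: "0 \<le> C1"
    "\<And>t \<tau>. \<lbrakk>0 \<le> t; 0 < \<tau>; t + \<tau> \<le> T\<rbrakk> \<Longrightarrow>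
       norm ((1/2) *\<^sub>R (u (t + \<tau>) + u t) - u (t + \<tau> / 2)) \<le> C1 * \<tau>\<^sup>2"
    by (rule average_at_midpoint[OF u_C2]) (rule that)
  define K where "K = K0 * (2 + C1)"
  have K: "0 \<le> K" using K0(1) C1(1) by (simp add: K_def)
  define C where "C = exp (6 * K * T) * (2 * K * (1 + T))"
  have C: "0 \<le> C" using K T_pos by (simp add: C_def)
  obtain \<tau>0 where \<tau>0: "0 < \<tau>0"
    "\<And>\<tau> y. \<lbrakk>0 < \<tau>; \<tau> \<le> \<tau>0; norm y \<le> R\<rbrakk> \<Longrightarrow>
       \<exists>y'. norm ((1/2) *\<^sub>R (y' + y)) \<le> R + 1 \<and> midpoint_step \<tau> ((1/2) *\<^sub>R (y' + y)) y y'"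
    by (rule implicit_step_solvable[OF f_in_Y R0]) (rule that)
  define \<tau>bar where "\<tau>bar = min (min 1 \<tau>0) (min (1 / (2 * K + 1)) (gap / (C + 1)))"
  have "0 < \<tau>bar" using \<tau>0(1) K C gap(1) by (simp add: \<tau>bar_def)
  moreover have
    "(\<exists>us. midpoint_solution j A f implicit_mid T \<tau> (u 0) us \<and> bounded_on_grid R T \<tau> us) \<and>
     (\<forall>us. midpoint_solution j A f implicit_mid T \<tau> (u 0) us \<and> bounded_on_grid R T \<tau> us \<longrightarrow>
        (\<forall>n. real n * \<tau> \<le> T \<longrightarrow> norm (us n - u (real n * \<tau>)) \<le> C * \<tau>\<^sup>2))"
    if "0 < \<tau> \<and> \<tau> \<le> \<tau>bar" for \<tau>
  proof -
    have \<tau>: "0 < \<tau>" "\<tau> \<le> 1" "\<tau> \<le> \<tau>0" "\<tau> \<le> 1 / (2 * K + 1)" "\<tau> \<le> gap / (C + 1)"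
      using that by (auto simp: \<tau>bar_def)
    have "\<tau> * (2 * K + 1) \<le> 1" using \<tau>(4) K by (simp add: pos_le_divide_eq)
    then have \<tau>K: "\<tau> * K \<le> 1 / 2" using \<tau>(1) by (simp add: algebra_simps)
    have \<tau>2: "\<tau>\<^sup>2 \<le> \<tau>" using \<tau>(1,2) by (simp add: power2_eq_square mult_left_le)
    have "C * \<tau>\<^sup>2 \<le> (C + 1) * \<tau>" using C \<tau>2 by (intro mult_mono) auto
    also have "\<dots> \<le> gap" using \<tau>(5) C by (simp add: pos_le_divide_eq mult.commute)
    finally have small: "C * \<tau>\<^sup>2 \<le> gap" .
    let ?G = "error_growth K \<tau>"
    have G_le: "?G n \<le> C * \<tau>\<^sup>2" if "real n * \<tau> \<le> T" for n
      unfolding C_def by (rule error_growth_le[OF K \<tau>(1) that])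
    have bounded: "norm y \<le> R" if "real n * \<tau> \<le> T" "norm (y - u (real n * \<tau>)) \<le> ?G n" for n y
    proof -
      have "norm (u (real n * \<tau>)) + gap \<le> R" using that \<tau>(1) by (intro gap(2)) auto
      then show ?thesis
        using norm_triangle_sub[of y "u (real n * \<tau>)"] that(2) G_le[OF that(1)] small by linarith
    qed
    have step: "norm (y' - u (real (Suc n) * \<tau>)) \<le> ?G (Suc n)"
      if n: "real (Suc n) * \<tau> \<le> T"
        and y: "norm (y - u (real n * \<tau>)) \<le> ?G n" "n = 0 \<Longrightarrow> y = u 0"
        and c: "norm ((1/2) *\<^sub>R (y' + y)) \<le> R + 1"
        and st: "midpoint_step \<tau> ((1/2) *\<^sub>R (y' + y)) y y'" for n y y'
    proof -
      define t where "t = real n * \<tau>"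
      have t: "0 \<le> t" "t + \<tau> \<le> T" "real (Suc n) * \<tau> = t + \<tau>"
        using n \<tau>(1) by (auto simp: t_def grid_successor simp del: of_nat_Suc)
      define e where "e = norm (y - u t)"
      define e' where "e' = norm (y' - u (t + \<tau>))"
      have "(1/2) *\<^sub>R (y' + y) - u (t + \<tau> / 2)
          = (1/2) *\<^sub>R ((y' - u (t + \<tau>)) + (y - u t)) + ((1/2) *\<^sub>R (u (t + \<tau>) + u t) - u (t + \<tau> / 2))"
        by (simp add: algebra_simps)
      also have "norm \<dots> \<le> norm ((1/2) *\<^sub>R ((y' - u (t + \<tau>)) + (y - u t))) + C1 * \<tau>\<^sup>2"
        using C1(2)[OF t(1) \<tau>(1) t(2)] by (intro order_trans[OF norm_triangle_ineq] add_left_mono)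
      also have "norm ((1/2) *\<^sub>R ((y' - u (t + \<tau>)) + (y - u t))) \<le> e' + e"
        unfolding e_def e'_def by (rule order_trans[OF _ norm_triangle_ineq]) simp
      finally have mid: "norm ((1/2) *\<^sub>R (y' + y) - u (t + \<tau> / 2)) \<le> e' + e + C1 * \<tau>\<^sup>2" by simp
      have nn: "0 \<le> e" "0 \<le> e'" by (auto simp: e_def e'_def)
      have "e' \<le> e + \<tau> * K0 * (e' + e + (norm ((1/2) *\<^sub>R (y' + y) - u (t + \<tau> / 2)) + \<tau>\<^sup>2))"
        unfolding e_def e'_def by (rule K0(2)[OF \<tau>(1) t(1,2) c st])
      also have "\<dots> \<le> e + \<tau> * K0 * (e' + e + ((e' + e + C1 * \<tau>\<^sup>2) + \<tau>\<^sup>2))"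
        using mid \<tau>(1) K0(1) by (intro add_left_mono mult_left_mono add_mono order_refl) auto
      also have "\<dots> \<le> e + \<tau> * K0 * ((2 + C1) * (e' + e + 0 + \<tau>\<^sup>2))"
      proof (intro add_left_mono mult_left_mono)
        have "0 \<le> C1 * (e' + e) + \<tau>\<^sup>2" using C1(1) nn by simp
        then show "e' + e + ((e' + e + C1 * \<tau>\<^sup>2) + \<tau>\<^sup>2) \<le> (2 + C1) * (e' + e + 0 + \<tau>\<^sup>2)"
          by (simp add: algebra_simps)
      qed (use \<tau>(1) K0(1) in auto)
      finally have rec: "e' \<le> e + \<tau> * K * (e' + e + 0 + \<tau>\<^sup>2)" by (simp add: K_def mult.assoc)
      have "e' \<le> ?G (Suc n)"
        by (rule discrete_gronwall_step[OF K \<tau>(1) \<tau>K _ _ _ _ rec])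
           (use y \<tau>2 error_growth_nonneg[OF K \<tau>(1)] in \<open>auto simp: e_def t_def\<close>)
      then show ?thesis by (simp only: e'_def t(3))
    qed
    have "\<exists>us. \<forall>n. (real n * \<tau> \<le> T \<longrightarrow>
          norm (us n - u (real n * \<tau>)) \<le> ?G n \<and> (n = 0 \<longrightarrow> us n = u 0)) \<and>
        (real (Suc n) * \<tau> \<le> T \<longrightarrow> midpoint_step \<tau> ((1/2) *\<^sub>R (us (Suc n) + us n)) (us n) (us (Suc n)))"
    proof (rule dependent_nat_choice)
      show "\<exists>x. real 0 * \<tau> \<le> T \<longrightarrow> norm (x - u (real 0 * \<tau>)) \<le> ?G 0 \<and> (0 = (0::nat) \<longrightarrow> x = u 0)"
        using error_growth_nonneg[OF K \<tau>(1)] by (intro exI[of _ "u 0"]) simp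
      fix x n
      assume x: "real n * \<tau> \<le> T \<longrightarrow> norm (x - u (real n * \<tau>)) \<le> ?G n \<and> (n = 0 \<longrightarrow> x = u 0)"
      show "\<exists>y. (real (Suc n) * \<tau> \<le> T \<longrightarrow>
              norm (y - u (real (Suc n) * \<tau>)) \<le> ?G (Suc n) \<and> (Suc n = 0 \<longrightarrow> y = u 0)) \<and>
            (real (Suc n) * \<tau> \<le> T \<longrightarrow> midpoint_step \<tau> ((1/2) *\<^sub>R (y + x)) x y)"
      proof (cases "real (Suc n) * \<tau> \<le> T")
        case True
        then have n: "real n * \<tau> \<le> T" using \<tau>(1) by (simp only: grid_successor)
        then have "norm x \<le> R" using x bounded by blast
        then obtain y where "norm ((1/2) *\<^sub>R (y + x)) \<le> R + 1" "midpoint_step \<tau> ((1/2) *\<^sub>R (y + x)) x y"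
          using \<tau>0(2)[OF \<tau>(1,3)] by blast
        then show ?thesis using step[OF True _ _] x n by blast
      qed blast
    qed
    then obtain us where us: "\<And>n. real n * \<tau> \<le> T \<Longrightarrow> norm (us n - u (real n * \<tau>)) \<le> ?G n \<and> (n = 0 \<longrightarrow> us n = u 0)"
      "\<And>n. real (Suc n) * \<tau> \<le> T \<Longrightarrow> midpoint_step \<tau> ((1/2) *\<^sub>R (us (Suc n) + us n)) (us n) (us (Suc n))"
      by blast
    have "midpoint_solution j A f implicit_mid T \<tau> (u 0) us"
      unfolding midpoint_solution_iff implicit_mid_def using us(1)[of 0] us(2) T_pos by simp
    moreover have "bounded_on_grid R T \<tau> us"
      unfolding bounded_on_grid_def using us(1) bounded by blast
    moreover have "norm (w n - u (real n * \<tau>)) \<le> C * \<tau>\<^sup>2"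
      if w: "midpoint_solution j A f implicit_mid T \<tau> (u 0) w" "bounded_on_grid R T \<tau> w"
        and n: "real n * \<tau> \<le> T" for w n
    proof -
      have "norm (w n - u (real n * \<tau>)) \<le> ?G n" using n
      proof (induction n)
        case 0
        then show ?case
          using w(1) error_growth_nonneg[OF K \<tau>(1)] by (simp add: midpoint_solution_iff)
      next
        case (Suc n)
        have n: "real n * \<tau> \<le> T" using Suc.prems \<tau>(1) by (simp only: grid_successor)
        have "norm (w n) \<le> R" "norm (w (Suc n)) \<le> R"
          using w(2) n Suc.prems unfolding bounded_on_grid_def by blast+
        then have "norm ((1/2) *\<^sub>R (w (Suc n) + w n)) \<le> R + 1"
          using norm_triangle_ineq[of "w (Suc n)" "w n"] by simp
        moreover have "midpoint_step \<tau> ((1/2) *\<^sub>R (w (Suc n) + w n)) (w n) (w (Suc n))"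
          using w(1) Suc.prems unfolding midpoint_solution_iff implicit_mid_def by blast
        moreover have "n = 0 \<Longrightarrow> w n = u 0" using w(1) by (simp add: midpoint_solution_iff)
        ultimately show ?case using step[OF Suc.prems Suc.IH[OF n]] by blast
      qed
      then show ?thesis using G_le[OF n] by linarith
    qed
    ultimately show ?thesis by blast
  qed
  ultimately show ?thesis by blast
qed

text \<open>
  The argument of the operators depends on the two preceding values, so the induction runs over pairs
  \<open>(p, y)\<close> of consecutive values, started with \<open>p = y = u 0\<close>. For this start the general extrapolation
  formula also yields the argument of the first step. Errors of at most \<open>1\<close> keep \<open>p\<close> and \<open>y\<close> within
  \<open>U + 1\<close> and the extrapolated argument within \<open>2 * (U + 1)\<close>.
\<close>

lemma extrapolated_midpoint_convergence:
  "\<exists>\<tau>bar>0. \<exists>C. \<forall>\<tau>. 0 < \<tau> \<and> \<tau> \<le> \<tau>bar \<longrightarrow>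
     (\<exists>us. midpoint_solution j A f extrapolated_mid T \<tau> (u 0) us) \<and>
     (\<forall>us. midpoint_solution j A f extrapolated_mid T \<tau> (u 0) us \<longrightarrow>
        (\<forall>n. real n * \<tau> \<le> T \<longrightarrow> norm (us n - u (real n * \<tau>)) \<le> C * \<tau>\<^sup>2))"
proof -
  obtain U where U: "0 \<le> U" "\<And>t. t \<in> {0..T} \<Longrightarrow> norm (u t) \<le> U"
    by (rule continuous_on_norm_bound[OF continuous_u]) (rule that)
  define R where "R = 2 * (U + 1)"
  have R1: "0 < R" using U(1) by (simp add: R_def)
  have R2: "norm (u t) \<le> R" if "t \<in> {0..T}" for t using U(2)[OF that] U(1) by (simp add: R_def)
  obtain K0 where K0: "0 \<le> K0"
    "\<And>\<tau> t c y y'. \<lbrakk>0 < \<tau>; 0 \<le> t; t + \<tau> \<le> T; norm c \<le> R; midpoint_step \<tau> c y y'\<rbrakk> \<Longrightarrow>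
       norm (y' - u (t + \<tau>)) \<le> norm (y - u t) + \<tau> * K0 *
         (norm (y' - u (t + \<tau>)) + norm (y - u t) + (norm (c - u (t + \<tau> / 2)) + \<tau>\<^sup>2))"
    by (rule one_step_error[OF R1 R2]) (assumption, rule that)
  obtain C1 where C1: "0 \<le> C1"
    "\<And>t \<tau>. \<lbrakk>\<tau> \<le> t; 0 < \<tau>; t + \<tau> \<le> T\<rbrakk> \<Longrightarrow>
       norm (u t + (1/2) *\<^sub>R (u t - u (t - \<tau>)) - u (t + \<tau> / 2)) \<le> C1 * \<tau>\<^sup>2"
    by (rule extrapolation_at_midpoint[OF u_C2]) (rule that)
  have u1: "Ck_on (Suc 2) {0..T} u" using u_smooth by (simp only: eval_nat_numeral)
  obtain C2 where C2: "0 \<le> C2"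
    "\<And>s t. \<lbrakk>s \<in> {0..T}; t \<in> {0..T}\<rbrakk> \<Longrightarrow> norm (u s - u t) \<le> C2 * \<bar>s - t\<bar>"
    by (rule Ck_on_Lipschitz[OF u1]) (rule that)
  define K where "K = K0 * (3 + C1 + C2)"
  have K: "0 \<le> K" using K0(1) C1(1) C2(1) by (simp add: K_def)
  define C where "C = exp (6 * K * T) * (2 * K * (1 + T))"
  have C: "0 \<le> C" using K T_pos by (simp add: C_def)
  obtain \<tau>0 where \<tau>0: "0 < \<tau>0"
    "\<And>\<tau> c y. \<lbrakk>0 < \<tau>; \<tau> \<le> \<tau>0; norm c \<le> R\<rbrakk> \<Longrightarrow> \<exists>y'. midpoint_step \<tau> c y y'"
    by (rule linear_step_solvable[OF f_in_Y R1]) (rule that)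
  define \<tau>bar where "\<tau>bar = min (min 1 \<tau>0) (min (1 / (2 * K + 1)) (1 / (C + 1)))"
  have "0 < \<tau>bar" using \<tau>0(1) K C by (simp add: \<tau>bar_def)
  moreover have
    "(\<exists>us. midpoint_solution j A f extrapolated_mid T \<tau> (u 0) us) \<and>
     (\<forall>us. midpoint_solution j A f extrapolated_mid T \<tau> (u 0) us \<longrightarrow>
        (\<forall>n. real n * \<tau> \<le> T \<longrightarrow> norm (us n - u (real n * \<tau>)) \<le> C * \<tau>\<^sup>2))"
    if "0 < \<tau> \<and> \<tau> \<le> \<tau>bar" for \<tau>
  proof -
    have \<tau>: "0 < \<tau>" "\<tau> \<le> 1" "\<tau> \<le> \<tau>0" "\<tau> \<le> 1 / (2 * K + 1)" "\<tau> \<le> 1 / (C + 1)"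
      using that by (auto simp: \<tau>bar_def)
    have "\<tau> * (2 * K + 1) \<le> 1" using \<tau>(4) K by (simp add: pos_le_divide_eq)
    then have \<tau>K: "\<tau> * K \<le> 1 / 2" using \<tau>(1) by (simp add: algebra_simps)
    have \<tau>2: "\<tau>\<^sup>2 \<le> \<tau>" using \<tau>(1,2) by (simp add: power2_eq_square mult_left_le)
    have "C * \<tau>\<^sup>2 \<le> (C + 1) * \<tau>" using C \<tau>2 by (intro mult_mono) auto
    also have "\<dots> \<le> 1" using \<tau>(5) C by (simp add: pos_le_divide_eq mult.commute)
    finally have small: "C * \<tau>\<^sup>2 \<le> 1" .
    let ?G = "error_growth K \<tau>"
    have G0: "0 \<le> ?G n" for n by (rule error_growth_nonneg[OF K \<tau>(1)])
    have G_le: "?G n \<le> C * \<tau>\<^sup>2" if "real n * \<tau> \<le> T" for n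
      unfolding C_def by (rule error_growth_le[OF K \<tau>(1) that])
    \<comment> \<open>For \<open>n = 0\<close> the truncated difference \<open>n - 1\<close> is \<open>0\<close>, which gives \<open>p\<close> the reference value \<open>u 0\<close>.\<close>
    define ok where "ok n p y \<longleftrightarrow> norm (y - u (real n * \<tau>)) \<le> ?G n \<and>
        norm (p - u (real (n - 1) * \<tau>)) \<le> ?G n \<and> (n = 0 \<longrightarrow> p = u 0 \<and> y = u 0)" for n p y
    define mid where "mid p y = y + (1/2) *\<^sub>R (y - p)" for p y :: 'y
    have bounded: "norm (mid p y) \<le> R" if n: "real n * \<tau> \<le> T" and "ok n p y" for n p y
    proof -
      have "real (n - 1) * \<tau> \<le> real n * \<tau>" using \<tau>(1) by (intro mult_right_mono) auto
      then have "real (n - 1) * \<tau> \<le> T" using n by linarith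
      then have "norm (u (real n * \<tau>)) \<le> U" "norm (u (real (n - 1) * \<tau>)) \<le> U"
        using n \<tau>(1) by (auto intro!: U(2))
      then have "norm y \<le> U + 1" "norm p \<le> U + 1"
        using norm_triangle_sub[of y "u (real n * \<tau>)"] norm_triangle_sub[of p "u (real (n - 1) * \<tau>)"]
          \<open>ok n p y\<close> G_le[OF n] small unfolding ok_def by linarith+
      moreover have "norm (mid p y) \<le> norm y + (1/2) * (norm y + norm p)"
        unfolding mid_def using norm_triangle_ineq4[of y p]
        by (intro order_trans[OF norm_triangle_ineq]) simp
      moreover have "m \<le> 2 * (U + 1)" if "a \<le> U + 1" "b \<le> U + 1" "m \<le> a + (1/2) * (a + b)" for a b m
        using that by (simp add: field_simps)
      ultimately show ?thesis unfolding R_def by blast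
    qed
    have step: "ok (Suc n) y y'"
      if n: "real (Suc n) * \<tau> \<le> T" and ok: "ok n p y" and st: "midpoint_step \<tau> (mid p y) y y'" for n p y y'
    proof -
      define t where "t = real n * \<tau>"
      have t: "0 \<le> t" "t + \<tau> \<le> T" "real (Suc n) * \<tau> = t + \<tau>"
        using n \<tau>(1) by (auto simp: t_def grid_successor simp del: of_nat_Suc)
      have c: "norm (mid p y) \<le> R"
        using bounded[OF _ ok] t(2) \<tau>(1) by (simp add: t_def)
      define e where "e = norm (y - u t)"
      define e' where "e' = norm (y' - u (t + \<tau>))"
      define a where "a = norm (p - u (real (n - 1) * \<tau>))"
      define \<delta> where "\<delta> = (if n = 0 then \<tau> else \<tau>\<^sup>2)"
      have nn: "0 \<le> e" "0 \<le> e'" "0 \<le> a" "\<tau>\<^sup>2 \<le> \<delta>" "0 \<le> \<delta>"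
        using \<tau>2 \<tau>(1) by (auto simp: e_def e'_def a_def \<delta>_def)
      have mid: "norm (mid p y - u (t + \<tau> / 2)) \<le> 2 * e + a + (C1 + C2) * \<delta>"
      proof (cases "n = 0")
        case True
        then have mid0: "mid p y = u t" using ok by (simp add: ok_def mid_def t_def)
        have "norm (u t - u (t + \<tau> / 2)) \<le> C2 * \<bar>t - (t + \<tau> / 2)\<bar>"
          using t \<tau>(1) by (intro C2(2)) auto
        also have "\<dots> \<le> (C1 + C2) * \<delta>"
          using \<tau>(1) C1(1) C2(1) True by (intro mult_mono) (auto simp: \<delta>_def)
        finally show ?thesis unfolding mid0 using nn(1,3) by linarith
      next
        case False
        then have "real (n - 1) * \<tau> = t - \<tau>" by (simp add: t_def of_nat_diff algebra_simps)
        then have a: "a = norm (p - u (t - \<tau>))" by (simp add: a_def)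
        have t1: "\<tau> \<le> t" using False \<tau>(1) by (simp add: t_def)
        have "mid p y - u (t + \<tau> / 2) = (y - u t) + (1/2) *\<^sub>R ((y - u t) - (p - u (t - \<tau>)))
            + (u t + (1/2) *\<^sub>R (u t - u (t - \<tau>)) - u (t + \<tau> / 2))"
          by (simp add: mid_def algebra_simps)
        also have "norm \<dots> \<le> (e + norm ((1/2) *\<^sub>R ((y - u t) - (p - u (t - \<tau>))))) + C1 * \<tau>\<^sup>2"
          unfolding e_def
          by (intro norm_triangle_le add_mono order_refl C1(2)[OF t1 \<tau>(1) t(2)])
        also have "norm ((1/2) *\<^sub>R ((y - u t) - (p - u (t - \<tau>)))) \<le> e + a"
          unfolding e_def a by (rule order_trans[OF _ norm_triangle_ineq4]) simp
        also have "C1 * \<tau>\<^sup>2 \<le> (C1 + C2) * \<delta>"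
          using False C1(1) C2(1) by (intro mult_mono) (auto simp: \<delta>_def)
        finally show ?thesis by simp
      qed
      have "e' \<le> e + \<tau> * K0 * (e' + e + (norm (mid p y - u (t + \<tau> / 2)) + \<tau>\<^sup>2))"
        unfolding e_def e'_def by (rule K0(2)[OF \<tau>(1) t(1,2) c st])
      also have "\<dots> \<le> e + \<tau> * K0 * (e' + e + ((2 * e + a + (C1 + C2) * \<delta>) + \<delta>))"
        using mid nn \<tau>(1) K0(1) by (intro add_left_mono mult_left_mono add_mono order_refl) auto
      also have "\<dots> \<le> e + \<tau> * K0 * ((3 + C1 + C2) * (e' + e + a + \<delta>))"
      proof (intro add_left_mono mult_left_mono)
        have "0 \<le> (C1 + C2) * (e' + e + a)" using C1(1) C2(1) nn by simp
        then show "e' + e + ((2 * e + a + (C1 + C2) * \<delta>) + \<delta>) \<le> (3 + C1 + C2) * (e' + e + a + \<delta>)"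
          using nn by (simp add: algebra_simps)
      qed (use \<tau>(1) K0(1) in auto)
      finally have rec: "e' \<le> e + \<tau> * K * (e' + e + a + \<delta>)" by (simp add: K_def mult.assoc)
      have "e' \<le> ?G (Suc n)"
        by (rule discrete_gronwall_step[OF K \<tau>(1) \<tau>K _ _ _ _ rec])
           (use ok in \<open>auto simp: ok_def e_def a_def t_def \<delta>_def\<close>)
      moreover have "e \<le> ?G (Suc n)"
        using ok error_growth_mono[OF K \<tau>(1), of n] unfolding ok_def e_def t_def by linarith
      ultimately show ?thesis unfolding ok_def e_def e'_def t(3) by (simp add: t_def)
    qed
    have "\<exists>ps. \<forall>n. (real n * \<tau> \<le> T \<longrightarrow> ok n (fst (ps n)) (snd (ps n))) \<and>
        fst (ps (Suc n)) = snd (ps n) \<and>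
        (real (Suc n) * \<tau> \<le> T \<longrightarrow>
          midpoint_step \<tau> (mid (fst (ps n)) (snd (ps n))) (snd (ps n)) (snd (ps (Suc n))))"
    proof (rule dependent_nat_choice)
      show "\<exists>x. real 0 * \<tau> \<le> T \<longrightarrow> ok 0 (fst x) (snd x)"
        using G0 by (intro exI[of _ "(u 0, u 0)"]) (simp add: ok_def)
      fix x n
      assume x: "real n * \<tau> \<le> T \<longrightarrow> ok n (fst x) (snd x)"
      show "\<exists>y. (real (Suc n) * \<tau> \<le> T \<longrightarrow> ok (Suc n) (fst y) (snd y)) \<and> fst y = snd x \<and>
          (real (Suc n) * \<tau> \<le> T \<longrightarrow> midpoint_step \<tau> (mid (fst x) (snd x)) (snd x) (snd y))"
      proof (cases "real (Suc n) * \<tau> \<le> T")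
        case True
        then have n: "real n * \<tau> \<le> T" using \<tau>(1) by (simp only: grid_successor)
        then have ok: "ok n (fst x) (snd x)" using x by blast
        obtain y where y: "midpoint_step \<tau> (mid (fst x) (snd x)) (snd x) y"
          using \<tau>0(2)[OF \<tau>(1,3) bounded[OF n ok]] by blast
        show ?thesis
          using step[OF True ok y] y by (intro exI[of _ "(snd x, y)"]) simp
      next
        case False
        then show ?thesis by (intro exI[of _ "(snd x, snd x)"]) simp
      qed
    qed
    then obtain ps where ps: "\<And>n. real n * \<tau> \<le> T \<Longrightarrow> ok n (fst (ps n)) (snd (ps n))"
      "\<And>n. fst (ps (Suc n)) = snd (ps n)"
      "\<And>n. real (Suc n) * \<tau> \<le> T \<Longrightarrow>
        midpoint_step \<tau> (mid (fst (ps n)) (snd (ps n))) (snd (ps n)) (snd (ps (Suc n)))"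
      by blast
    have mid_eq: "extrapolated_mid w n = mid (w (n - 1)) (w n)" for w n
      by (simp add: extrapolated_mid_def mid_def)
    define us where "us n = snd (ps n)" for n
    have start: "fst (ps 0) = u 0" "us 0 = u 0" using ps(1)[of 0] T_pos by (auto simp: ok_def us_def)
    have "fst (ps n) = us (n - 1)" for n using start ps(2) by (cases n) (auto simp: us_def)
    then have "midpoint_solution j A f extrapolated_mid T \<tau> (u 0) us"
      unfolding midpoint_solution_iff mid_eq using ps(3) start(2) by (metis us_def)
    moreover have "norm (w n - u (real n * \<tau>)) \<le> C * \<tau>\<^sup>2"
      if w: "midpoint_solution j A f extrapolated_mid T \<tau> (u 0) w" and n: "real n * \<tau> \<le> T" for w n
    proof -
      have "ok n (w (n - 1)) (w n)" using n
      proof (induction n)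
        case 0
        then show ?case using w G0 by (simp add: midpoint_solution_iff ok_def)
      next
        case (Suc n)
        have n: "real n * \<tau> \<le> T" using Suc.prems \<tau>(1) by (simp only: grid_successor)
        have "midpoint_step \<tau> (mid (w (n - 1)) (w n)) (w n) (w (Suc n))"
          using w Suc.prems unfolding midpoint_solution_iff mid_eq by blast
        then show ?case using step[OF Suc.prems Suc.IH[OF n]] by simp
      qed
      then show ?thesis using G_le[OF n] unfolding ok_def by linarith
    qed
    ultimately show ?thesis by blast
  qed
  ultimately show ?thesis by blast
qed

end

theorem theorem3p1:
  fixes j :: "'y::{real_inner,complete_space} \<Rightarrow> 'x::{real_inner,complete_space}"
    and D :: "'y \<Rightarrow> 'x set" and A B :: "'y \<Rightarrow> 'x \<Rightarrow> 'x" and S :: "'y \<Rightarrow> 'x" and f :: "'x \<Rightarrow> 'x"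
    and MA MB LA LB lX lY :: "real \<Rightarrow> real"
    and T :: real and u v :: "real \<Rightarrow> 'y"
  assumes "dense_embedding j"
    and "kato_K1 j D A MA"
    and "kato_K2 j D A S B MB"
    and "kato_K3 j A B LA LB"
    and "kato_K4 j f lX lY"
    and "T > 0"
    and "evolution_solution j A f T u"
    and "Ck_on 3 {0..T} u"
    and "\<forall>t\<in>{0..T}. S (u t) = j (v t)" and "Ck_on 2 {0..T} v"
  shows
    "(\<forall>R. (\<forall>t\<in>{0..T}. norm (u t) < R) \<longrightarrow>
       (\<exists>\<tau>bar>0. \<exists>C. \<forall>\<tau>. 0 < \<tau> \<and> \<tau> \<le> \<tau>bar \<longrightarrow>
          (\<exists>us. midpoint_solution j A f implicit_mid T \<tau> (u 0) us \<and> bounded_on_grid R T \<tau> us) \<and>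
          (\<forall>us. midpoint_solution j A f implicit_mid T \<tau> (u 0) us \<and> bounded_on_grid R T \<tau> us \<longrightarrow>
             (\<forall>n. real n * \<tau> \<le> T \<longrightarrow> norm (us n - u (real n * \<tau>)) \<le> C * \<tau>\<^sup>2))))
     \<and>
     (\<exists>\<tau>bar>0. \<exists>C. \<forall>\<tau>. 0 < \<tau> \<and> \<tau> \<le> \<tau>bar \<longrightarrow>
        (\<exists>us. midpoint_solution j A f extrapolated_mid T \<tau> (u 0) us) \<and>
        (\<forall>us. midpoint_solution j A f extrapolated_mid T \<tau> (u 0) us \<longrightarrow>
           (\<forall>n. real n * \<tau> \<le> T \<longrightarrow> norm (us n - u (real n * \<tau>)) \<le> C * \<tau>\<^sup>2)))"
proof -
  interpret kato_evolution j D A B S f MA MB LA LB lX lY T u v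
    by (intro kato_evolution.intro kato_operators.intro kato_evolution_axioms.intro) (fact assms)+
  show ?thesis
    by (intro conjI allI impI implicit_midpoint_convergence extrapolated_midpoint_convergence) blast
qed

end
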